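(* If $M$ is a Rees monoid, then its group of fractions $U(M)$ is a group HNN-extension. Conversely, every group HNN-extension of a group $G$ is (isomorphic to) the group of fractions of a Rees monoid.
   Context: A monoid $M$ is a left Rees monoid if: it is left cancellative; it is right rigid, i.e. $aM\cap bM\neq\emptyset$ implies $aM\subseteq bM$ or $bM\subseteq aM$; each principal right ideal is properly contained in only finitely many principal right ideals; and, by convention, $M$ is not a group. Right Rees monoids are defined dually (right cancellative, left rigid, each principal left ideal properly contained in only finitely many principal left ideals). A Rees monoid is a monoid which is both left Rees and right Rees. The group of fractions $U(M)$ of a monoid $M$ is the group with a homomorphism $u:M\to U(M)$ such that every homomorphism from $M$ to a group factors uniquely through $u$. Group HNN-extension: let $G$ be a group, $I$ a (non-empty) index set, $H_i$ ($i\in I$) subgroups of $G$ and $\rho_i:H_i\to G$ injective homomorphisms. The group HNN-extension of $G$ is the group with group presentation $$\langle G,\ t_i\ (i\in I)\ |\ \mathcal{R}(G),\ h t_i=t_i\rho_i(h)\ \ \forall h\in H_i,\ i\in I\rangle ,$$ where $\mathcal{R}(G)$ denotes the relations of $G$. *)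

theory Defs
  imports "HOL-Algebra.Coset"
begin

section \<open>Rees monoids\<close>

abbreviation principal_right_ideal :: "('a, 'm) monoid_scheme \<Rightarrow> 'a \<Rightarrow> 'a set" where
  "principal_right_ideal M a \<equiv> a <#\<^bsub>M\<^esub> carrier M"

abbreviation principal_left_ideal :: "('a, 'm) monoid_scheme \<Rightarrow> 'a \<Rightarrow> 'a set" where
  "principal_left_ideal M a \<equiv> carrier M #>\<^bsub>M\<^esub> a"

definition left_cancellative :: "('a, 'm) monoid_scheme \<Rightarrow> bool" where
  "left_cancellative M \<longleftrightarrow>
     (\<forall>a\<in>carrier M. \<forall>x\<in>carrier M. \<forall>y\<in>carrier M. a \<otimes>\<^bsub>M\<^esub> x = a \<otimes>\<^bsub>M\<^esub> y \<longrightarrow> x = y)"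

definition right_cancellative :: "('a, 'm) monoid_scheme \<Rightarrow> bool" where
  "right_cancellative M \<longleftrightarrow>
     (\<forall>a\<in>carrier M. \<forall>x\<in>carrier M. \<forall>y\<in>carrier M. x \<otimes>\<^bsub>M\<^esub> a = y \<otimes>\<^bsub>M\<^esub> a \<longrightarrow> x = y)"

definition right_rigid :: "('a, 'm) monoid_scheme \<Rightarrow> bool" where
  "right_rigid M \<longleftrightarrow>
     (\<forall>a\<in>carrier M. \<forall>b\<in>carrier M.
        principal_right_ideal M a \<inter> principal_right_ideal M b \<noteq> {} \<longrightarrow>
        principal_right_ideal M a \<subseteq> principal_right_ideal M b \<or>
        principal_right_ideal M b \<subseteq> principal_right_ideal M a)"

definition left_rigid :: "('a, 'm) monoid_scheme \<Rightarrow> bool" where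
  "left_rigid M \<longleftrightarrow>
     (\<forall>a\<in>carrier M. \<forall>b\<in>carrier M.
        principal_left_ideal M a \<inter> principal_left_ideal M b \<noteq> {} \<longrightarrow>
        principal_left_ideal M a \<subseteq> principal_left_ideal M b \<or>
        principal_left_ideal M b \<subseteq> principal_left_ideal M a)"

definition left_rees_monoid :: "('a, 'm) monoid_scheme \<Rightarrow> bool" where
  "left_rees_monoid M \<longleftrightarrow>
     monoid M \<and> left_cancellative M \<and> right_rigid M \<and>
     (\<forall>a\<in>carrier M. finite {J \<in> principal_right_ideal M ` carrier M.
                              principal_right_ideal M a \<subset> J}) \<and>
     \<not> group M"

definition right_rees_monoid :: "('a, 'm) monoid_scheme \<Rightarrow> bool" where
  "right_rees_monoid M \<longleftrightarrow>
     monoid M \<and> right_cancellative M \<and> left_rigid M \<and>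
     (\<forall>a\<in>carrier M. finite {J \<in> principal_left_ideal M ` carrier M.
                              principal_left_ideal M a \<subset> J}) \<and>
     \<not> group M"

definition rees_monoid :: "('a, 'm) monoid_scheme \<Rightarrow> bool" where
  "rees_monoid M \<longleftrightarrow> left_rees_monoid M \<and> right_rees_monoid M"


section \<open>Group presentations\<close>

text \<open>The letter \<open>(True, x)\<close> stands for the generator \<open>x\<close>, and \<open>(False, x)\<close> for its formal
  inverse.\<close>

type_synonym 'x gword = "(bool \<times> 'x) list"

definition gwords :: "'x set \<Rightarrow> 'x gword set" where
  "gwords X = lists (UNIV \<times> X)"

text \<open>The least congruence on the words over \<open>X\<close> and their formal inverses that contains the
  relations \<open>R\<close> and makes \<open>(b, x)\<close> and \<open>(\<not> b, x)\<close> mutually inverse.\<close>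

inductive pres_cong ::
    "'x set \<Rightarrow> ('x gword \<times> 'x gword) set \<Rightarrow> 'x gword \<Rightarrow> 'x gword \<Rightarrow> bool"
  for X :: "'x set" and R :: "('x gword \<times> 'x gword) set" where
  rel: "(u, v) \<in> R \<Longrightarrow> u \<in> gwords X \<Longrightarrow> v \<in> gwords X \<Longrightarrow> pres_cong X R u v"
| cancel: "x \<in> X \<Longrightarrow> pres_cong X R [(b, x), (\<not> b, x)] []"
| refl: "w \<in> gwords X \<Longrightarrow> pres_cong X R w w"
| sym: "pres_cong X R u v \<Longrightarrow> pres_cong X R v u"
| trans: "pres_cong X R u v \<Longrightarrow> pres_cong X R v w \<Longrightarrow> pres_cong X R u w"
| append: "pres_cong X R u v \<Longrightarrow> pres_cong X R u' v' \<Longrightarrow> pres_cong X R (u @ u') (v @ v')"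

definition pres_class ::
    "'x set \<Rightarrow> ('x gword \<times> 'x gword) set \<Rightarrow> 'x gword \<Rightarrow> 'x gword set" where
  "pres_class X R w = {v. pres_cong X R w v}"

definition presented_group ::
    "'x set \<Rightarrow> ('x gword \<times> 'x gword) set \<Rightarrow> 'x gword set monoid" where
  "presented_group X R =
     \<lparr>carrier = pres_class X R ` gwords X,
      mult = (\<lambda>A B. {w. \<exists>a\<in>A. \<exists>b\<in>B. pres_cong X R (a @ b) w}),
      one = pres_class X R []\<rparr>"

definition table_relations :: "('a, 'm) monoid_scheme \<Rightarrow> ('a gword \<times> 'a gword) set" where
  "table_relations M =
     {([(True, a), (True, b)], [(True, a \<otimes>\<^bsub>M\<^esub> b)]) | a b. a \<in> carrier M \<and> b \<in> carrier M}"

lemma pres_cong_gwords: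
  "pres_cong X R u v \<Longrightarrow> u \<in> gwords X \<and> v \<in> gwords X"
  by (induction rule: pres_cong.induct) (auto simp: gwords_def)

lemma pres_class_eq_iff:
  assumes "u \<in> gwords X"
  shows "pres_class X R u = pres_class X R v \<longleftrightarrow> pres_cong X R u v"
proof
  assume "pres_class X R u = pres_class X R v"
  moreover have "u \<in> pres_class X R u"
    using assms by (simp add: pres_class_def pres_cong.refl)
  ultimately show "pres_cong X R u v"
    by (simp add: pres_class_def pres_cong.sym)
next
  assume "pres_cong X R u v"
  then show "pres_class X R u = pres_class X R v"
    unfolding pres_class_def by (blast intro: pres_cong.sym pres_cong.trans)
qed

lemma mult_pres_class:
  assumes "u \<in> gwords X" "v \<in> gwords X"
  shows "pres_class X R u \<otimes>\<^bsub>presented_group X R\<^esub> pres_class X R v = pres_class X R (u @ v)"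
proof -
  have "pres_cong X R (u @ v) w"
    if "pres_cong X R u a" "pres_cong X R v b" "pres_cong X R (a @ b) w" for a b w
    using pres_cong.trans[OF pres_cong.append[OF that(1,2)] that(3)] .
  moreover have "pres_cong X R u u" "pres_cong X R v v"
    using assms by (auto intro: pres_cong.refl)
  ultimately show ?thesis
    unfolding presented_group_def pres_class_def by auto
qed

lemma gwords_append [intro]: "u \<in> gwords X \<Longrightarrow> v \<in> gwords X \<Longrightarrow> u @ v \<in> gwords X"
  by (auto simp: gwords_def)

lemma gwords_Nil [intro, simp]: "[] \<in> gwords X"
  by (auto simp: gwords_def)

lemma gwords_Cons [simp]: "l # w \<in> gwords X \<longleftrightarrow> snd l \<in> X \<and> w \<in> gwords X"
  by (cases l) (auto simp: gwords_def)

lemma gwords_inverse: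
  assumes "w \<in> gwords X"
  shows "\<exists>w'\<in>gwords X. pres_cong X R (w' @ w) []"
  using assms
proof (induction w)
  case Nil
  then show ?case by (auto intro!: bexI[of _ "[]"] pres_cong.refl)
next
  case (Cons l w)
  obtain b x where l: "l = (b, x)" by (cases l)
  from Cons have x: "x \<in> X" and w: "w \<in> gwords X" by (auto simp: l)
  then obtain w' where w': "w' \<in> gwords X" "pres_cong X R (w' @ w) []"
    using Cons.IH by blast
  have "pres_cong X R ([(\<not> b, x), (\<not> \<not> b, x)] @ w) ([] @ w)"
    by (intro pres_cong.append pres_cong.cancel pres_cong.refl x w)
  with pres_cong.refl[OF w'(1)]
  have "pres_cong X R (w' @ ([(\<not> b, x), (\<not> \<not> b, x)] @ w)) (w' @ ([] @ w))"
    by (rule pres_cong.append)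
  then have "pres_cong X R ((w' @ [(\<not> b, x)]) @ l # w) []"
    using pres_cong.trans[OF _ w'(2)] by (simp add: l)
  moreover have "w' @ [(\<not> b, x)] \<in> gwords X"
    using w' x by (intro gwords_append) auto
  ultimately show ?case by blast
qed

lemma carrier_presented_group [simp]:
  "carrier (presented_group X R) = pres_class X R ` gwords X"
  by (simp add: presented_group_def)

lemma one_presented_group [simp]:
  "\<one>\<^bsub>presented_group X R\<^esub> = pres_class X R []"
  by (simp add: presented_group_def)

lemma group_presented_group: "group (presented_group X R)"
proof (rule groupI)
  fix A assume "A \<in> carrier (presented_group X R)"
  then obtain w where w: "w \<in> gwords X" "A = pres_class X R w" by auto
  with gwords_inverse[of w X R] obtain w' where
    w': "w' \<in> gwords X" "pres_cong X R (w' @ w) []" by blast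
  then show "\<exists>B\<in>carrier (presented_group X R). B \<otimes>\<^bsub>presented_group X R\<^esub> A = \<one>\<^bsub>presented_group X R\<^esub>"
    using w by (intro bexI[of _ "pres_class X R w'"])
      (auto simp: mult_pres_class pres_class_eq_iff gwords_append)
qed (auto simp: mult_pres_class gwords_append)

fun eval_gword :: "('h, 'k) monoid_scheme \<Rightarrow> ('x \<Rightarrow> 'h) \<Rightarrow> 'x gword \<Rightarrow> 'h" where
  "eval_gword H \<phi> [] = \<one>\<^bsub>H\<^esub>"
| "eval_gword H \<phi> ((b, x) # w) =
     (if b then \<phi> x else inv\<^bsub>H\<^esub> (\<phi> x)) \<otimes>\<^bsub>H\<^esub> eval_gword H \<phi> w"

lemma (in group) eval_gword_closed:
  "\<phi> \<in> X \<rightarrow> carrier G \<Longrightarrow> w \<in> gwords X \<Longrightarrow> eval_gword G \<phi> w \<in> carrier G"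
  by (induction w) (auto simp: Pi_iff split: if_splits)

lemma (in group) eval_gword_append:
  assumes "\<phi> \<in> X \<rightarrow> carrier G" "u \<in> gwords X" "v \<in> gwords X"
  shows "eval_gword G \<phi> (u @ v) = eval_gword G \<phi> u \<otimes> eval_gword G \<phi> v"
  using assms(2)
proof (induction u)
  case Nil
  then show ?case using assms by (simp add: eval_gword_closed)
next
  case (Cons l u)
  moreover have "eval_gword G \<phi> u \<in> carrier G" "eval_gword G \<phi> v \<in> carrier G"
    using assms Cons by (auto intro: eval_gword_closed)
  ultimately show ?case using assms(1) by (cases l) (auto simp: m_assoc Pi_iff)
qed

lemma (in group) eval_gword_cong:
  assumes \<phi>: "\<phi> \<in> X \<rightarrow> carrier G"
    and R: "\<And>u v. (u, v) \<in> R \<Longrightarrow> u \<in> gwords X \<Longrightarrow> v \<in> gwords X \<Longrightarrow>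
              eval_gword G \<phi> u = eval_gword G \<phi> v"
    and "pres_cong X R u v"
  shows "eval_gword G \<phi> u = eval_gword G \<phi> v"
  using assms(3)
proof (induction rule: pres_cong.induct)
  case (cancel x b)
  then show ?case using \<phi> by (cases b) (auto simp: Pi_iff)
next
  case (append u v u' v')
  then show ?case using \<phi> by (simp add: eval_gword_append pres_cong_gwords)
qed (auto intro: R)

lemma presented_group_universal:
  fixes H :: "('h, 'k) monoid_scheme"
  assumes "group H" and \<phi>: "\<phi> \<in> X \<rightarrow> carrier H"
    and R: "\<And>u v. (u, v) \<in> R \<Longrightarrow> u \<in> gwords X \<Longrightarrow> v \<in> gwords X \<Longrightarrow>
              eval_gword H \<phi> u = eval_gword H \<phi> v"
  shows "\<exists>!g. g \<in> hom (presented_group X R) H \<inter> extensional (carrier (presented_group X R)) \<and>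
              (\<forall>x\<in>X. g (pres_class X R [(True, x)]) = \<phi> x)"
proof -
  interpret H: group H by fact
  let ?P = "presented_group X R"
  interpret P: group ?P by (rule group_presented_group)
  have ex: "\<forall>A\<in>carrier ?P. \<exists>h. \<forall>w\<in>gwords X. A = pres_class X R w \<longrightarrow> h = eval_gword H \<phi> w"
    using H.eval_gword_cong[OF \<phi> R] by (auto simp: pres_class_eq_iff)
  then obtain g0 where g0: "\<And>w. w \<in> gwords X \<Longrightarrow> g0 (pres_class X R w) = eval_gword H \<phi> w"
    by (subst (asm) bchoice_iff) auto
  define g where "g = restrict g0 (carrier ?P)"
  have g: "g (pres_class X R w) = eval_gword H \<phi> w" if "w \<in> gwords X" for w
    using that by (simp add: g_def g0)
  have "g \<in> hom ?P H"
    by (auto simp: hom_def g mult_pres_class gwords_append H.eval_gword_append[OF \<phi>]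
        H.eval_gword_closed[OF \<phi>])
  moreover have "\<forall>x\<in>X. g (pres_class X R [(True, x)]) = \<phi> x"
    using \<phi> by (auto simp: g Pi_iff)
  moreover have "h = g"
    if h: "h \<in> hom ?P H" "h \<in> extensional (carrier ?P)"
      "\<forall>x\<in>X. h (pres_class X R [(True, x)]) = \<phi> x" for h
  proof (rule extensionalityI[OF h(2)])
    show "g \<in> extensional (carrier ?P)" by (simp add: g_def)
    interpret h: group_hom ?P H h by unfold_locales (rule h(1))
    have letter: "h (pres_class X R [(b, x)]) = (if b then \<phi> x else inv\<^bsub>H\<^esub> (\<phi> x))" if x: "x \<in> X" for b x
    proof (cases b)
      case False
      have "pres_class X R [(False, x)] \<otimes>\<^bsub>?P\<^esub> pres_class X R [(True, x)] = \<one>\<^bsub>?P\<^esub>"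
        using x pres_cong.cancel[of x X R False] by (simp add: mult_pres_class pres_class_eq_iff)
      then have "pres_class X R [(False, x)] = inv\<^bsub>?P\<^esub> (pres_class X R [(True, x)])"
        using x by (intro P.inv_equality[symmetric]) auto
      then show ?thesis using False h(3) x by simp
    qed (use h(3) x in simp)
    have "h (pres_class X R w) = eval_gword H \<phi> w" if "w \<in> gwords X" for w
      using that
    proof (induction w)
      case Nil
      then show ?case using h.hom_one by simp
    next
      case (Cons l w)
      obtain b x where l: "l = (b, x)" by (cases l)
      have "pres_class X R (l # w) = pres_class X R [l] \<otimes>\<^bsub>?P\<^esub> pres_class X R w"
        using Cons by (simp add: mult_pres_class)
      then have "h (pres_class X R (l # w)) = h (pres_class X R [l]) \<otimes>\<^bsub>H\<^esub> h (pres_class X R w)"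
        using Cons.prems h.hom_mult[of "pres_class X R [l]" "pres_class X R w"] by simp
      then show ?case using Cons letter[of x b] by (simp add: l)
    qed
    then show "\<And>A. A \<in> carrier ?P \<Longrightarrow> h A = g A" by (auto simp: g)
  qed
  moreover have "g \<in> extensional (carrier ?P)" by (simp add: g_def)
  ultimately show ?thesis by blast
qed


section \<open>The group of fractions of a monoid\<close>

text \<open>\<open>g\<close> is taken extensional so that uniqueness of homomorphisms out of \<open>U\<close> refers only to
  their values on the carrier.\<close>

definition factors_uniquely ::
    "('a, 'm) monoid_scheme \<Rightarrow> ('u, 'n) monoid_scheme \<Rightarrow> ('a \<Rightarrow> 'u) \<Rightarrow> ('h, 'k) monoid_scheme \<Rightarrow> bool" where
  "factors_uniquely M U u H \<longleftrightarrow>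
     (\<forall>f\<in>hom M H. \<exists>!g. g \<in> hom U H \<inter> extensional (carrier U) \<and>
                        (\<forall>x\<in>carrier M. g (u x) = f x))"

text \<open>A definition cannot quantify over all types, so the universal property is required for
  the target groups carried by two types only: the type of \<open>U\<close> itself, and the type of the
  group presented by the multiplication table of \<open>M\<close>. By
  \<open>group_of_fractions_universal\<close> below, it then holds for groups of every type, and
  \<open>group_of_fractions_exists\<close> shows that such a group always exists.\<close>

definition is_group_of_fractions ::
    "('a, 'm) monoid_scheme \<Rightarrow> ('u, 'n) monoid_scheme \<Rightarrow> ('a \<Rightarrow> 'u) \<Rightarrow> bool" where
  "is_group_of_fractions M U u \<longleftrightarrow>
     group U \<and> u \<in> hom M U \<and>
     (\<forall>H :: 'u monoid. group H \<longrightarrow> factors_uniquely M U u H) \<and>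
     (\<forall>H :: 'a gword set monoid. group H \<longrightarrow> factors_uniquely M U u H)"

lemma table_group_hom:
  "(\<lambda>a. pres_class (carrier M) (table_relations M) [(True, a)])
     \<in> hom M (presented_group (carrier M) (table_relations M))" if "monoid M"
proof -
  interpret monoid M by fact
  have "pres_cong (carrier M) (table_relations M) [(True, a \<otimes>\<^bsub>M\<^esub> b)] [(True, a), (True, b)]"
    if "a \<in> carrier M" "b \<in> carrier M" for a b
    by (rule pres_cong.sym, rule pres_cong.rel) (use that in \<open>auto simp: table_relations_def\<close>)
  then show ?thesis
    unfolding hom_def by (auto simp: mult_pres_class pres_class_eq_iff)
qed

lemma table_group_universal:
  fixes M :: "('a, 'm) monoid_scheme" and H :: "('h, 'k) monoid_scheme"
  assumes "monoid M" "group H"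
  shows "factors_uniquely M (presented_group (carrier M) (table_relations M))
           (\<lambda>a. pres_class (carrier M) (table_relations M) [(True, a)]) H"
  unfolding factors_uniquely_def
proof
  interpret H: group H by fact
  interpret M: monoid M by fact
  fix f assume f: "f \<in> hom M H"
  then have f': "f \<in> carrier M \<rightarrow> carrier H" by (auto simp: hom_def)
  show "\<exists>!g. g \<in> hom (presented_group (carrier M) (table_relations M)) H \<inter>
               extensional (carrier (presented_group (carrier M) (table_relations M))) \<and>
             (\<forall>x\<in>carrier M. g (pres_class (carrier M) (table_relations M) [(True, x)]) = f x)"
    by (rule presented_group_universal[OF assms(2) f'])
      (use f f' in \<open>auto simp: table_relations_def hom_mult Pi_iff\<close>)
qed

lemma group_of_fractions_exists:
  assumes "monoid M"
  shows "is_group_of_fractions M (presented_group (carrier M) (table_relations M))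
           (\<lambda>a. pres_class (carrier M) (table_relations M) [(True, a)])"
  using assms
  by (simp add: is_group_of_fractions_def group_presented_group table_group_hom
      table_group_universal del: carrier_presented_group)

lemma hom_truncate: "hom A (monoid.truncate H) = hom A H" "hom (monoid.truncate H) A = hom H A"
  by (auto simp: hom_def monoid.truncate_def)

lemma group_truncate: "group H \<Longrightarrow> group (monoid.truncate H)"
  by (rule groupI) (auto simp: monoid.truncate_def group.is_monoid monoid.m_closed
      monoid.one_closed monoid.m_assoc monoid.l_one intro: group.l_inv_ex)

lemma factors_uniquelyE:
  assumes "factors_uniquely M U u H" "f \<in> hom M H"
  obtains g where "g \<in> hom U H" "\<And>x. x \<in> carrier M \<Longrightarrow> g (u x) = f x"
proof -
  from assms have "\<exists>!g. g \<in> hom U H \<inter> extensional (carrier U) \<and> (\<forall>x\<in>carrier M. g (u x) = f x)"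
    unfolding factors_uniquely_def by (rule bspec)
  then have "\<exists>g. g \<in> hom U H \<inter> extensional (carrier U) \<and> (\<forall>x\<in>carrier M. g (u x) = f x)"
    by (rule ex1_implies_ex)
  then obtain g where "g \<in> hom U H \<inter> extensional (carrier U)" "\<forall>x\<in>carrier M. g (u x) = f x"
    by (elim exE conjE)
  then show thesis by (intro that[of g]) simp_all
qed

lemma factors_uniquely_eqI:
  assumes "factors_uniquely M U u H" "monoid M" "group H" "u \<in> hom M U"
    and "g1 \<in> hom U H" "g2 \<in> hom U H" "\<And>x. x \<in> carrier M \<Longrightarrow> g1 (u x) = g2 (u x)"
    and "y \<in> carrier U" and "group U"
  shows "g1 y = g2 y"
proof -
  interpret U: group U by fact
  have u: "u x \<in> carrier U" if "x \<in> carrier M" for x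
    using that assms(4) by (auto simp: hom_def)
  have "(\<lambda>x. g1 (u x)) \<in> hom M H"
    using hom_compose[OF assms(4,5)] by (simp add: o_def)
  with assms(1) have ex1: "\<exists>!g. g \<in> hom U H \<inter> extensional (carrier U) \<and>
      (\<forall>x\<in>carrier M. g (u x) = g1 (u x))"
    unfolding factors_uniquely_def by (rule bspec)
  have r: "restrict g1 (carrier U) \<in> hom U H" "restrict g2 (carrier U) \<in> hom U H"
    using assms(5,6) by (auto simp: hom_def)
  from ex1 have "restrict g1 (carrier U) = restrict g2 (carrier U)"
  proof (rule ex1E)
    fix g
    assume "\<forall>g'. g' \<in> hom U H \<inter> extensional (carrier U) \<and>
        (\<forall>x\<in>carrier M. g' (u x) = g1 (u x)) \<longrightarrow> g' = g"
    from spec[OF this, of "restrict g1 (carrier U)"] spec[OF this, of "restrict g2 (carrier U)"]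
    show ?thesis using r u assms(7) by simp
  qed
  then show ?thesis using assms(8) by (metis restrict_apply')
qed

theorem group_of_fractions_universal:
  fixes M :: "('a, 'm) monoid_scheme" and U :: "('u, 'n) monoid_scheme"
    and H :: "('h, 'k) monoid_scheme"
  assumes M: "monoid M" and U: "is_group_of_fractions M U u" and H: "group H"
  shows "factors_uniquely M U u H"
  unfolding factors_uniquely_def
proof
  define P where "P = presented_group (carrier M) (table_relations M)"
  define p where "p = (\<lambda>a. pres_class (carrier M) (table_relations M) [(True, a)])"
  have gP: "group P" by (simp add: P_def group_presented_group)
  have p: "p \<in> hom M P" unfolding P_def p_def by (rule table_group_hom[OF M])
  have gU: "group U" and u: "u \<in> hom M U"
    using U by (auto simp: is_group_of_fractions_def)
  define U' where "U' = monoid.truncate U"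
  have gU': "group U'" using gU by (simp add: U'_def group_truncate)
  have uU': "factors_uniquely M U u U'" and uP: "factors_uniquely M U u P"
    using U gU' gP by (auto simp: is_group_of_fractions_def)
  have pH: "factors_uniquely M P p H" and pU: "factors_uniquely M P p U"
    unfolding P_def p_def by (rule table_group_universal[OF M]; fact)+
  have uc: "u x \<in> carrier U" if "x \<in> carrier M" for x
    using that u by (auto simp: hom_def)
  obtain a where a: "a \<in> hom U P" "\<And>x. x \<in> carrier M \<Longrightarrow> a (u x) = p x"
    by (rule factors_uniquelyE[OF uP p]) (rule that)
  obtain b where b: "b \<in> hom P U" "\<And>x. x \<in> carrier M \<Longrightarrow> b (p x) = u x"
    by (rule factors_uniquelyE[OF pU u]) (rule that)
  have ba: "b (a y) = y" if "y \<in> carrier U" for y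
  proof -
    have "(b \<circ> a) y = id y"
    proof (rule factors_uniquely_eqI[where ?g1.0 = "b \<circ> a" and ?g2.0 = id and y = y, OF uU' M gU' u])
      show "b \<circ> a \<in> hom U U'" using hom_compose[OF a(1) b(1)] by (simp add: U'_def hom_truncate)
      show "id \<in> hom U U'" by (auto simp: U'_def hom_def monoid.truncate_def)
    qed (use that gU a b in auto)
    then show ?thesis by simp
  qed
  fix f assume f: "f \<in> hom M H"
  obtain c where c: "c \<in> hom P H" "\<And>x. x \<in> carrier M \<Longrightarrow> c (p x) = f x"
    by (rule factors_uniquelyE[OF pH f]) (rule that)
  define g where "g = restrict (c \<circ> a) (carrier U)"
  have ca: "c \<circ> a \<in> hom U H" using hom_compose[OF a(1) c(1)] .
  interpret U: group U by fact
  have "g \<in> hom U H" using ca by (auto simp: g_def hom_def)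
  moreover have "\<forall>x\<in>carrier M. g (u x) = f x" using a c uc by (simp add: g_def)
  moreover have "h = g"
    if h: "h \<in> hom U H" "h \<in> extensional (carrier U)" "\<forall>x\<in>carrier M. h (u x) = f x" for h
  proof (rule extensionalityI[OF h(2)])
    show "g \<in> extensional (carrier U)" by (simp add: g_def)
    fix y assume y: "y \<in> carrier U"
    have ay: "a y \<in> carrier P" using a y by (auto simp: hom_def)
    have "(h \<circ> b) (a y) = c (a y)"
      by (rule factors_uniquely_eqI[OF pH M H p hom_compose[OF b(1) h(1)] c(1) _ ay gP])
        (use b c h in auto)
    then show "h y = g y" using y by (simp add: g_def ba)
  qed
  moreover have "g \<in> extensional (carrier U)" by (simp add: g_def)
  ultimately show "\<exists>!g. g \<in> hom U H \<inter> extensional (carrier U) \<and> (\<forall>x\<in>carrier M. g (u x) = f x)"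
    by blast
qed


section \<open>Group HNN-extensions\<close>

definition HNN_data ::
    "('g, 'm) monoid_scheme \<Rightarrow> 'i set \<Rightarrow> ('i \<Rightarrow> 'g set) \<Rightarrow> ('i \<Rightarrow> 'g \<Rightarrow> 'g) \<Rightarrow> bool" where
  "HNN_data G I H \<rho> \<longleftrightarrow>
     group G \<and> I \<noteq> {} \<and>
     (\<forall>i\<in>I. subgroup (H i) G \<and> \<rho> i \<in> mon (G\<lparr>carrier := H i\<rparr>) G)"

text \<open>Generators: \<open>Inl g\<close> for \<open>g \<in> G\<close> and \<open>Inr i\<close> for the stable letter \<open>t\<^sub>i\<close>. The relations of
  \<open>G\<close> are given by its multiplication table.\<close>

definition HNN_relations ::
    "('g, 'm) monoid_scheme \<Rightarrow> 'i set \<Rightarrow> ('i \<Rightarrow> 'g set) \<Rightarrow> ('i \<Rightarrow> 'g \<Rightarrow> 'g) \<Rightarrow>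
     (('g + 'i) gword \<times> ('g + 'i) gword) set" where
  "HNN_relations G I H \<rho> =
     map_prod (map (map_prod id Inl)) (map (map_prod id Inl)) ` table_relations G \<union>
     {([(True, Inl h), (True, Inr i)], [(True, Inr i), (True, Inl (\<rho> i h))]) | h i.
        i \<in> I \<and> h \<in> H i}"

definition HNN_extension ::
    "('g, 'm) monoid_scheme \<Rightarrow> 'i set \<Rightarrow> ('i \<Rightarrow> 'g set) \<Rightarrow> ('i \<Rightarrow> 'g \<Rightarrow> 'g) \<Rightarrow>
     ('g + 'i) gword set monoid" where
  "HNN_extension G I H \<rho> = presented_group (carrier G <+> I) (HNN_relations G I H \<rho>)"

definition is_HNN_extension ::
    "('e, 'n) monoid_scheme \<Rightarrow>
     ('g, 'm) monoid_scheme \<Rightarrow> 'i set \<Rightarrow> ('i \<Rightarrow> 'g set) \<Rightarrow> ('i \<Rightarrow> 'g \<Rightarrow> 'g) \<Rightarrow> bool" where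
  "is_HNN_extension E G I H \<rho> \<longleftrightarrow>
     HNN_data G I H \<rho> \<and> group E \<and> E \<cong> HNN_extension G I H \<rho>"

end

theory Submission
  imports Defs "HOL-Algebra.Bij"
begin

text \<open>From a Rees monoid to an HNN-extension. In a left Rees monoid \<open>M\<close> every element is a unit or a
  product of atoms (irreducible non-units), because only finitely many principal right ideals lie
  above a given one. Rigidity makes the factorization rigid as well: if \<open>a x = b y\<close> with atoms
  \<open>a\<close>, \<open>b\<close>, then \<open>b = a z\<close> for a unit \<open>z\<close>, so two factorizations differ only by units moved
  between neighbouring atoms. Hence a homomorphism from \<open>M\<close> to a group is the same as a
  homomorphism on the units together with a compatible assignment on the atoms
  (\<open>letter_map.ex_extension\<close>). Choose a representative \<open>i\<close> of every double coset of atoms modulo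
  the group of units \<open>G\<close>, and let \<open>H i\<close> consist of the units \<open>g\<close> with \<open>g i = i h\<close> for some unit
  \<open>h =: \<rho> i g\<close>. Then \<open>g i h = g' i h'\<close> holds exactly when the HNN-relations force it, so \<open>M\<close> maps
  to the HNN-extension of \<open>G\<close>; the universal properties of both groups turn this map into an
  isomorphism. Right cancellation makes \<open>\<rho> i\<close> injective.

  From an HNN-extension to a Rees monoid. Let \<open>M\<close> be the submonoid of \<open>E\<close> generated by \<open>G\<close> and the
  stable letters, that is, the set of positive elements. The relations of \<open>E\<close> hold already in \<open>M\<close>,
  so every homomorphism from \<open>M\<close> to a group extends to \<open>E\<close>, uniquely since \<open>M\<close> generates \<open>E\<close>.
  It remains to see that \<open>M\<close> is rigid and has a degree. For this \<open>E\<close> acts on normal forms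
  \<open>g t\<^sub>1 s\<^sub>1 \<dots> t\<^sub>n s\<^sub>n\<close>, with coset representatives \<open>s\<^sub>k\<close> (van der Waerden's argument). Multiplying
  positive elements with each other only ever adds letters, so the normal form of a positive element records
  the number of its letters, and comparing first letters shows that \<open>g t\<^sub>i x = t\<^sub>j y\<close> forces
  \<open>i = j\<close> and \<open>g \<in> H i\<close> (\<open>positive_first_letter\<close>); then \<open>g\<close> can be moved past \<open>t\<^sub>i\<close> and \<open>t\<^sub>i\<close>
  cancelled, which proves rigidity by induction (\<open>positive_rigid\<close>). All of this is done for the
  letters \<open>t\<^sub>i\<close> and \<open>t\<^sub>i\<inverse>\<close> simultaneously, with a sign \<open>e\<close> as parameter: the statement for the
  negative sign speaks of the inverses of positive elements, and so is the left-right dual needed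
  for the right Rees property.\<close>

section \<open>The universal property of a group HNN-extension\<close>

definition HNN_base ::
    "('g, 'm) monoid_scheme \<Rightarrow> 'i set \<Rightarrow> ('i \<Rightarrow> 'g set) \<Rightarrow> ('i \<Rightarrow> 'g \<Rightarrow> 'g) \<Rightarrow> 'g \<Rightarrow> ('g + 'i) gword set"
  where "HNN_base G I H \<rho> g =
     pres_class (carrier G <+> I) (HNN_relations G I H \<rho>) [(True, Inl g)]"

definition HNN_stable ::
    "('g, 'm) monoid_scheme \<Rightarrow> 'i set \<Rightarrow> ('i \<Rightarrow> 'g set) \<Rightarrow> ('i \<Rightarrow> 'g \<Rightarrow> 'g) \<Rightarrow> 'i \<Rightarrow> ('g + 'i) gword set"
  where "HNN_stable G I H \<rho> i =
     pres_class (carrier G <+> I) (HNN_relations G I H \<rho>) [(True, Inr i)]"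

lemma Inl_mem_Plus [simp]: "Inl a \<in> A <+> B \<longleftrightarrow> a \<in> A"
  and Inr_mem_Plus [simp]: "Inr b \<in> A <+> B \<longleftrightarrow> b \<in> B"
  by auto

lemma ball_Plus: "(\<forall>x\<in>A <+> B. P x) \<longleftrightarrow> (\<forall>a\<in>A. P (Inl a)) \<and> (\<forall>b\<in>B. P (Inr b))"
  by auto

lemma HNN_base_hom:
  assumes "HNN_data G I H \<rho>"
  shows "HNN_base G I H \<rho> \<in> hom G (HNN_extension G I H \<rho>)"
proof (rule homI)
  interpret G: group G using assms by (simp add: HNN_data_def)
  fix x y assume x: "x \<in> carrier G" and y: "y \<in> carrier G"
  have "([(True, Inl x), (True, Inl y)], [(True, Inl (x \<otimes>\<^bsub>G\<^esub> y))]) \<in> HNN_relations G I H \<rho>"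
    unfolding HNN_relations_def table_relations_def using x y
    by (force simp: image_iff)
  then show "HNN_base G I H \<rho> (x \<otimes>\<^bsub>G\<^esub> y) =
      HNN_base G I H \<rho> x \<otimes>\<^bsub>HNN_extension G I H \<rho>\<^esub> HNN_base G I H \<rho> y"
    using x y unfolding HNN_base_def HNN_extension_def
    by (simp add: mult_pres_class pres_class_eq_iff) (intro pres_cong.sym[OF pres_cong.rel]; simp)
qed (simp add: HNN_base_def HNN_extension_def)

lemma HNN_stable_closed:
  "i \<in> I \<Longrightarrow> HNN_stable G I H \<rho> i \<in> carrier (HNN_extension G I H \<rho>)"
  by (simp add: HNN_stable_def HNN_extension_def)

lemma HNN_associated_closed:
  assumes "HNN_data G I H \<rho>" "i \<in> I" "h \<in> H i"
  shows "h \<in> carrier G" "\<rho> i h \<in> carrier G"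
proof -
  have "subgroup (H i) G" and \<rho>: "\<rho> i \<in> hom (G\<lparr>carrier := H i\<rparr>) G"
    using assms by (auto simp: HNN_data_def mon_def)
  then show "h \<in> carrier G" "\<rho> i h \<in> carrier G"
    using assms(3) subgroup.mem_carrier hom_in_carrier[OF \<rho>] by fastforce+
qed

lemma HNN_stable_relation:
  assumes "HNN_data G I H \<rho>" and i: "i \<in> I" and h: "h \<in> H i"
  shows "HNN_base G I H \<rho> h \<otimes>\<^bsub>HNN_extension G I H \<rho>\<^esub> HNN_stable G I H \<rho> i =
    HNN_stable G I H \<rho> i \<otimes>\<^bsub>HNN_extension G I H \<rho>\<^esub> HNN_base G I H \<rho> (\<rho> i h)"
proof -
  note G = HNN_associated_closed[OF assms]
  have "([(True, Inl h), (True, Inr i)], [(True, Inr i), (True, Inl (\<rho> i h))]) \<in> HNN_relations G I H \<rho>"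
    using i h by (auto simp: HNN_relations_def)
  then show ?thesis
    using G i unfolding HNN_base_def HNN_stable_def HNN_extension_def
    by (simp add: mult_pres_class pres_class_eq_iff pres_cong.rel)
qed

text \<open>The presentation, read as a statement about homomorphisms. It is applied with three kinds of
  target: a permutation group (to make the extension act on normal forms), an arbitrary group
  receiving a monoid of positive elements, and the group of fractions of a Rees monoid.\<close>

lemma HNN_universal:
  fixes T :: "('t, 'k) monoid_scheme"
  assumes D: "HNN_data G I H \<rho>" and T: "group T" and f: "f \<in> hom G T"
    and \<tau>: "\<tau> \<in> I \<rightarrow> carrier T"
    and rel: "\<And>i h. i \<in> I \<Longrightarrow> h \<in> H i \<Longrightarrow> f h \<otimes>\<^bsub>T\<^esub> \<tau> i = \<tau> i \<otimes>\<^bsub>T\<^esub> f (\<rho> i h)"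
  shows "\<exists>!\<phi>. \<phi> \<in> hom (HNN_extension G I H \<rho>) T \<inter> extensional (carrier (HNN_extension G I H \<rho>)) \<and>
    (\<forall>g\<in>carrier G. \<phi> (HNN_base G I H \<rho> g) = f g) \<and>
    (\<forall>i\<in>I. \<phi> (HNN_stable G I H \<rho> i) = \<tau> i)"
proof -
  interpret T: group T by fact
  have fT: "f g \<in> carrier T" if "g \<in> carrier G" for g
    using f that by (rule hom_in_carrier)
  let ?\<phi> = "case_sum f \<tau>"
  have \<phi>: "?\<phi> \<in> carrier G <+> I \<rightarrow> carrier T"
    using fT \<tau> by auto
  have "\<exists>!\<phi>. \<phi> \<in> hom (HNN_extension G I H \<rho>) T \<inter> extensional (carrier (HNN_extension G I H \<rho>)) \<and>
     (\<forall>x\<in>carrier G <+> I. \<phi> (pres_class (carrier G <+> I) (HNN_relations G I H \<rho>) [(True, x)]) = ?\<phi> x)"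
    unfolding HNN_extension_def
  proof (rule presented_group_universal[OF T \<phi>])
    fix u v assume "(u, v) \<in> HNN_relations G I H \<rho>" and u: "u \<in> gwords (carrier G <+> I)"
      and v: "v \<in> gwords (carrier G <+> I)"
    then consider a b where "a \<in> carrier G" "b \<in> carrier G"
        "u = [(True, Inl a), (True, Inl b)]" "v = [(True, Inl (a \<otimes>\<^bsub>G\<^esub> b))]"
      | i h where "i \<in> I" "h \<in> H i" "u = [(True, Inl h), (True, Inr i)]"
        "v = [(True, Inr i), (True, Inl (\<rho> i h))]"
      unfolding HNN_relations_def table_relations_def by force
    then show "eval_gword T ?\<phi> u = eval_gword T ?\<phi> v"
    proof cases
      case 1
      then show ?thesis using f fT v by (simp add: hom_mult)
    next
      case 2
      then have "h \<in> carrier G" "\<rho> i h \<in> carrier G" using u v by auto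
      then show ?thesis using 2 rel fT \<tau> by (simp add: Pi_iff)
    qed
  qed
  then show ?thesis
    by (simp only: HNN_base_def HNN_stable_def ball_Plus sum.case)
qed

text \<open>The uniqueness half of the universal property, for homomorphisms that need not be extensional.\<close>

lemma HNN_hom_eqI:
  fixes T :: "('t, 'k) monoid_scheme"
  assumes D: "HNN_data G I H \<rho>" and T: "group T"
    and \<phi>: "\<phi>\<^sub>1 \<in> hom (HNN_extension G I H \<rho>) T" "\<phi>\<^sub>2 \<in> hom (HNN_extension G I H \<rho>) T"
    and base: "\<And>g. g \<in> carrier G \<Longrightarrow> \<phi>\<^sub>1 (HNN_base G I H \<rho> g) = \<phi>\<^sub>2 (HNN_base G I H \<rho> g)"
    and stable: "\<And>i. i \<in> I \<Longrightarrow> \<phi>\<^sub>1 (HNN_stable G I H \<rho> i) = \<phi>\<^sub>2 (HNN_stable G I H \<rho> i)"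
    and x: "x \<in> carrier (HNN_extension G I H \<rho>)"
  shows "\<phi>\<^sub>1 x = \<phi>\<^sub>2 x"
proof -
  let ?P = "HNN_extension G I H \<rho>"
  note bP = hom_in_carrier[OF HNN_base_hom[OF D]]
  have tP: "HNN_stable G I H \<rho> i \<in> carrier ?P" if "i \<in> I" for i
    using that by (rule HNN_stable_closed)
  define f where "f = (\<lambda>g. \<phi>\<^sub>1 (HNN_base G I H \<rho> g))"
  define \<tau> where "\<tau> = (\<lambda>i. \<phi>\<^sub>1 (HNN_stable G I H \<rho> i))"
  have f: "f \<in> hom G T"
    using hom_compose[OF HNN_base_hom[OF D] \<phi>(1)] by (simp add: f_def o_def)
  have \<tau>: "\<tau> \<in> I \<rightarrow> carrier T"
    using hom_in_carrier[OF \<phi>(1) tP] by (simp add: \<tau>_def)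
  have "\<exists>!\<phi>. \<phi> \<in> hom ?P T \<inter> extensional (carrier ?P) \<and>
      (\<forall>g\<in>carrier G. \<phi> (HNN_base G I H \<rho> g) = f g) \<and> (\<forall>i\<in>I. \<phi> (HNN_stable G I H \<rho> i) = \<tau> i)"
  proof (rule HNN_universal[OF D T f \<tau>])
    fix i h assume i: "i \<in> I" and h: "h \<in> H i"
    show "f h \<otimes>\<^bsub>T\<^esub> \<tau> i = \<tau> i \<otimes>\<^bsub>T\<^esub> f (\<rho> i h)"
      using HNN_stable_relation[OF D i h] HNN_associated_closed[OF D i h] bP tP[OF i]
      by (simp add: f_def \<tau>_def flip: hom_mult[OF \<phi>(1)])
  qed
  then have unique: "\<phi> = \<phi>'"
    if "\<phi> \<in> hom ?P T \<inter> extensional (carrier ?P)"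
      "\<forall>g\<in>carrier G. \<phi> (HNN_base G I H \<rho> g) = f g" "\<forall>i\<in>I. \<phi> (HNN_stable G I H \<rho> i) = \<tau> i"
      "\<phi>' \<in> hom ?P T \<inter> extensional (carrier ?P)"
      "\<forall>g\<in>carrier G. \<phi>' (HNN_base G I H \<rho> g) = f g" "\<forall>i\<in>I. \<phi>' (HNN_stable G I H \<rho> i) = \<tau> i"
    for \<phi> \<phi>'
    using that by (elim ex1E) metis
  interpret P: group ?P unfolding HNN_extension_def by (rule group_presented_group)
  have hom_restrict: "restrict \<phi> (carrier ?P) \<in> hom ?P T" if "\<phi> \<in> hom ?P T" for \<phi>
    using that by (auto simp: hom_def)
  have "restrict \<phi>\<^sub>1 (carrier ?P) = restrict \<phi>\<^sub>2 (carrier ?P)"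
    by (rule unique) (use \<phi>[THEN hom_restrict] bP tP base stable in \<open>simp_all add: f_def \<tau>_def\<close>)
  then show ?thesis using x by (metis restrict_apply')
qed

section \<open>Normal forms\<close>

locale HNN_pair = group G for G (structure) +
  fixes I :: "'i set" and H :: "'i \<Rightarrow> 'a set" and \<rho> :: "'i \<Rightarrow> 'a \<Rightarrow> 'a"
  assumes data: "HNN_data G I H \<rho>"
begin

text \<open>The letters \<open>t\<^sub>i\<close> (\<open>e = True\<close>) and \<open>t\<^sub>i\<inverse>\<close> (\<open>e = False\<close>) are treated alike: \<open>edge_sub e i\<close> is the
  subgroup whose elements can be moved from the right of the letter to its left, turning \<open>k\<close> into
  \<open>edge_map e i k\<close>. The two signs are exchanged by inverting \<open>edge_map\<close>.\<close>

definition edge_sub :: "bool \<Rightarrow> 'i \<Rightarrow> 'a set" where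
  "edge_sub e i = (if e then \<rho> i ` H i else H i)"

definition edge_map :: "bool \<Rightarrow> 'i \<Rightarrow> 'a \<Rightarrow> 'a" where
  "edge_map e i = (if e then inv_into (H i) (\<rho> i) else \<rho> i)"

lemma subgroup_H: "i \<in> I \<Longrightarrow> subgroup (H i) G"
  and \<rho>_hom: "i \<in> I \<Longrightarrow> \<rho> i \<in> hom (G\<lparr>carrier := H i\<rparr>) G"
  and \<rho>_inj: "i \<in> I \<Longrightarrow> inj_on (\<rho> i) (H i)"
  using data by (auto simp: HNN_data_def mon_def)

lemma subgroup_edge_sub: "i \<in> I \<Longrightarrow> subgroup (edge_sub e i) G"
proof (cases e)
  case True
  assume i: "i \<in> I"
  interpret K: group "G\<lparr>carrier := H i\<rparr>"
    using subgroup_H[OF i] by (rule subgroup.subgroup_is_group) simp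
  interpret h: group_hom "G\<lparr>carrier := H i\<rparr>" G "\<rho> i"
    using \<rho>_hom[OF i] by unfold_locales
  show ?thesis using h.img_is_subgroup True by (simp add: edge_sub_def)
qed (simp add: edge_sub_def subgroup_H)

lemma edge_sub_closed: "i \<in> I \<Longrightarrow> k \<in> edge_sub e i \<Longrightarrow> k \<in> carrier G"
  using subgroup_edge_sub subgroup.mem_carrier by fast

lemma edge_map_in: "i \<in> I \<Longrightarrow> k \<in> edge_sub e i \<Longrightarrow> edge_map e i k \<in> edge_sub (\<not> e) i"
  by (auto simp: edge_sub_def edge_map_def inv_into_into \<rho>_inj)

lemma edge_map_closed: "i \<in> I \<Longrightarrow> k \<in> edge_sub e i \<Longrightarrow> edge_map e i k \<in> carrier G"
  using edge_map_in edge_sub_closed by blast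

lemma edge_map_inverse:
  "i \<in> I \<Longrightarrow> k \<in> edge_sub e i \<Longrightarrow> edge_map (\<not> e) i (edge_map e i k) = k"
  by (auto simp: edge_sub_def edge_map_def \<rho>_inj split: if_splits)

lemma edge_map_mult:
  assumes "i \<in> I" "k \<in> edge_sub e i" "l \<in> edge_sub e i"
  shows "edge_map e i (k \<otimes> l) = edge_map e i k \<otimes> edge_map e i l"
proof (cases e)
  case True
  then obtain h h' where h: "h \<in> H i" "h' \<in> H i" "k = \<rho> i h" "l = \<rho> i h'"
    using assms by (auto simp: edge_sub_def)
  moreover have "h \<otimes> h' \<in> H i" using h subgroup_H[OF assms(1)] by (simp add: subgroup.m_closed)
  moreover have "\<rho> i (h \<otimes> h') = k \<otimes> l"
    using hom_mult[OF \<rho>_hom[OF assms(1)], of h h'] h by simp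
  ultimately show ?thesis using True \<rho>_inj[OF assms(1)]
    by (simp add: edge_map_def) (metis inv_into_f_f)
next
  case False
  then show ?thesis using hom_mult[OF \<rho>_hom[OF assms(1)], of k l] assms
    by (simp add: edge_map_def edge_sub_def)
qed

text \<open>A transversal of the right cosets of \<open>K\<close> in which \<open>K\<close> itself is represented by \<open>\<one>\<close>. The latter
  is what makes a cancelling pair \<open>t \<one> t\<inverse>\<close> visible in a normal form.\<close>

definition coset_rep :: "'a set \<Rightarrow> 'a \<Rightarrow> 'a" where
  "coset_rep K g = (if g \<in> K then \<one> else (SOME x. x \<in> K #> g))"

lemma coset_rep_mem:
  assumes "subgroup K G" "g \<in> carrier G"
  shows "coset_rep K g \<in> K #> g"
proof (cases "g \<in> K")
  case True
  then have "K #> g = K" using assms by (simp add: coset_join2)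
  then show ?thesis using True assms by (simp add: coset_rep_def subgroup.one_closed)
next
  case False
  have "g \<in> K #> g" using assms by (rule rcos_self[rotated])
  then show ?thesis using False unfolding coset_rep_def by (auto intro: someI)
qed

lemma coset_rep_closed: "subgroup K G \<Longrightarrow> g \<in> carrier G \<Longrightarrow> coset_rep K g \<in> carrier G"
  using coset_rep_mem r_coset_subset_G subgroup.subset by blast

lemma coset_rep_mult:
  assumes "subgroup K G" "k \<in> K" "g \<in> carrier G"
  shows "coset_rep K (k \<otimes> g) = coset_rep K g"
proof -
  have k: "k \<in> carrier G" using assms by (simp add: subgroup.mem_carrier)
  have "k \<otimes> g \<in> K \<longleftrightarrow> g \<in> K"
    using assms k
    by (metis subgroup.m_closed subgroup.m_inv_closed inv_solve_left m_closed)
  moreover have "K #> (k \<otimes> g) = K #> g"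
    using assms k by (metis coset_assoc coset_join2 coset_mult_assoc subgroup.subset)
  ultimately show ?thesis by (simp add: coset_rep_def)
qed

lemma coset_rep_factor:
  assumes "subgroup K G" "g \<in> carrier G"
  shows "g \<otimes> inv (coset_rep K g) \<in> K"
proof -
  obtain k where k: "k \<in> K" "coset_rep K g = k \<otimes> g"
    using coset_rep_mem[OF assms] by (auto simp: r_coset_def)
  have "k \<in> carrier G" using assms k by (simp add: subgroup.mem_carrier)
  then have "g \<otimes> inv (coset_rep K g) = inv k"
    using k(2) assms(2) by (simp add: inv_mult_group m_assoc[symmetric])
  then show ?thesis using k(1) assms(1) by (simp add: subgroup.m_inv_closed)
qed

lemma coset_rep_idem:
  assumes "subgroup K G" "g \<in> carrier G"
  shows "coset_rep K (coset_rep K g) = coset_rep K g"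
  using coset_rep_mem[OF assms] coset_rep_mult[OF assms(1) _ assms(2)]
  by (auto simp: r_coset_def)

lemma coset_rep_in: "k \<in> K \<Longrightarrow> coset_rep K k = \<one>"
  by (simp add: coset_rep_def)

definition starts :: "bool \<Rightarrow> 'i \<Rightarrow> (bool \<times> 'i \<times> 'a) list \<Rightarrow> bool" where
  "starts e i L \<longleftrightarrow> (\<exists>s L'. L = (e, i, s) # L')"

text \<open>The pair \<open>(g, [(e\<^sub>1, i\<^sub>1, s\<^sub>1), \<dots>])\<close> stands for the product \<open>g t\<^sub>1 s\<^sub>1 t\<^sub>2 s\<^sub>2 \<dots>\<close>, where \<open>t\<^sub>k\<close> is the
  letter with index \<open>i\<^sub>k\<close> and sign \<open>e\<^sub>k\<close>. Keeping the unrestricted coefficient \<open>g\<close> on the left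
  makes left multiplication by \<open>G\<close> trivial and left multiplication by a letter a single step.\<close>

fun reduced :: "(bool \<times> 'i \<times> 'a) list \<Rightarrow> bool" where
  "reduced [] \<longleftrightarrow> True"
| "reduced ((e, i, s) # L) \<longleftrightarrow>
     i \<in> I \<and> s \<in> carrier G \<and> coset_rep (edge_sub e i) s = s \<and>
     \<not> (s = \<one> \<and> starts (\<not> e) i L) \<and> reduced L"

definition normal_forms :: "('a \<times> (bool \<times> 'i \<times> 'a) list) set" where
  "normal_forms = {(g, L). g \<in> carrier G \<and> reduced L}"

text \<open>Left multiplication by the letter \<open>t\<close> of index \<open>i\<close> and sign \<open>e\<close>: write \<open>g = l s\<close> with
  \<open>l \<in> edge_sub e i\<close> and \<open>s\<close> the representative, and replace \<open>t l\<close> by \<open>k t\<close>. If \<open>s = \<one>\<close> and the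
  word starts with the inverse letter, the two letters cancel.\<close>

definition push :: "bool \<Rightarrow> 'i \<Rightarrow> 'a \<times> (bool \<times> 'i \<times> 'a) list \<Rightarrow> 'a \<times> (bool \<times> 'i \<times> 'a) list" where
  "push e i = (\<lambda>(g, L).
     let s = coset_rep (edge_sub e i) g; k = edge_map e i (g \<otimes> inv s)
     in if s = \<one> \<and> starts (\<not> e) i L then (k \<otimes> snd (snd (hd L)), tl L)
        else (k, (e, i, s) # L))"

text \<open>This is the relation \<open>t k = edge_map e i k \<cdot> t\<close> of the HNN-extension, as an identity of operations
  on normal forms.\<close>

lemma push_mult:
  assumes i: "i \<in> I" and k: "k \<in> edge_sub e i" and g: "g \<in> carrier G" and "(g, L) \<in> normal_forms"
  shows "push e i (k \<otimes> g, L) = apfst ((\<otimes>) (edge_map e i k)) (push e i (g, L))"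
proof -
  note K = subgroup_edge_sub[OF i, of e]
  let ?s = "coset_rep (edge_sub e i) g"
  have kG: "k \<in> carrier G" using edge_sub_closed[OF i k] .
  have "?s \<in> carrier G" using K g by (rule coset_rep_closed)
  moreover have l: "g \<otimes> inv ?s \<in> edge_sub e i" using K g by (rule coset_rep_factor)
  ultimately have "edge_map e i (k \<otimes> g \<otimes> inv ?s) = edge_map e i k \<otimes> edge_map e i (g \<otimes> inv ?s)"
    using edge_map_mult[OF i k l] kG g by (simp add: m_assoc)
  moreover have "starts (\<not> e) i L \<Longrightarrow> snd (snd (hd L)) \<in> carrier G"
    using assms(4) by (auto simp: normal_forms_def starts_def)
  ultimately show ?thesis
    using edge_map_closed[OF i k] edge_map_closed[OF i l] 
    by (auto simp: push_def Let_def coset_rep_mult[OF K k g] m_assoc)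
qed

text \<open>Pushing a letter and then its inverse undoes the first step in both cases: a pushed letter is
  cancelled again, and after a cancellation the reduced remainder cannot cancel once more, so the
  removed letter is restored with its old representative.\<close>

lemma push_closed_inverse:
  assumes i: "i \<in> I" and x: "x \<in> normal_forms"
  shows "push e i x \<in> normal_forms \<and> push (\<not> e) i (push e i x) = x"
proof -
  obtain g L where x': "x = (g, L)" and g: "g \<in> carrier G" and L: "reduced L"
    using x by (auto simp: normal_forms_def)
  note K = subgroup_edge_sub[OF i, of e] and K' = subgroup_edge_sub[OF i, of "\<not> e"]
  define s where "s = coset_rep (edge_sub e i) g"
  define l where "l = g \<otimes> inv s"
  define k where "k = edge_map e i l"
  have s: "s \<in> carrier G" "coset_rep (edge_sub e i) s = s"
    using K g by (simp_all add: s_def coset_rep_closed coset_rep_idem)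
  have l: "l \<in> edge_sub e i" using coset_rep_factor[OF K g] by (simp add: l_def s_def)
  have k: "k \<in> edge_sub (\<not> e) i" "k \<in> carrier G" "edge_map (\<not> e) i k = l"
    using l i by (simp_all add: k_def edge_map_in edge_map_closed edge_map_inverse)
  have ls: "l \<otimes> s = g" using g s by (simp add: l_def m_assoc)
  show ?thesis
  proof (cases "s = \<one> \<and> starts (\<not> e) i L")
    case True
    then obtain s' L' where L': "L = (\<not> e, i, s') # L'" by (auto simp: starts_def)
    with L have s': "s' \<in> carrier G" "coset_rep (edge_sub (\<not> e) i) s' = s'" "reduced L'"
      "\<not> (s' = \<one> \<and> starts e i L')" by auto
    have eq: "push e i x = (k \<otimes> s', L')"
      unfolding push_def x' Let_def prod.case s_def[symmetric] l_def[symmetric] k_def[symmetric]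
      using True by (simp add: L')
    have "coset_rep (edge_sub (\<not> e) i) (k \<otimes> s') = s'"
      using coset_rep_mult[OF K' k(1) s'(1)] s' by simp
    moreover have "k \<otimes> s' \<otimes> inv s' = k" using k s' by (simp add: m_assoc)
    ultimately have "push (\<not> e) i (k \<otimes> s', L') = (l, L)"
      using s' k by (simp add: push_def L' Let_def) blast
    then show ?thesis using eq k s' ls True g by (simp add: normal_forms_def x' l_def)
  next
    case False
    then have eq: "push e i x = (k, (e, i, s) # L)"
      by (auto simp: push_def x' simp flip: s_def l_def k_def)
    have "push (\<not> e) i (k, (e, i, s) # L) = (l \<otimes> s, L)"
      using k by (simp add: push_def Let_def coset_rep_in starts_def)
    then show ?thesis using eq False s i k L ls by (simp add: normal_forms_def x')
  qed
qed

lemma push_closed: "i \<in> I \<Longrightarrow> x \<in> normal_forms \<Longrightarrow> push e i x \<in> normal_forms"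
  and push_inverse: "i \<in> I \<Longrightarrow> x \<in> normal_forms \<Longrightarrow> push (\<not> e) i (push e i x) = x"
  using push_closed_inverse by blast+

definition left_mult :: "'a \<Rightarrow> 'a \<times> (bool \<times> 'i \<times> 'a) list \<Rightarrow> 'a \<times> (bool \<times> 'i \<times> 'a) list" where
  "left_mult g = apfst ((\<otimes>) g)"

lemma left_mult_in_Bij:
  assumes "g \<in> carrier G"
  shows "restrict (left_mult g) normal_forms \<in> Bij normal_forms"
proof -
  have "bij_betw (left_mult g) normal_forms normal_forms"
    by (rule bij_betwI[of _ _ _ "left_mult (inv g)"])
      (use assms in \<open>auto simp: left_mult_def normal_forms_def m_assoc[symmetric]\<close>)
  then show ?thesis by (simp add: Bij_def)
qed

lemma push_in_Bij:
  assumes "i \<in> I"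
  shows "restrict (push e i) normal_forms \<in> Bij normal_forms"
proof -
  have "bij_betw (push e i) normal_forms normal_forms"
    by (rule bij_betwI[of _ _ _ "push (\<not> e) i"])
      (use assms push_inverse[of i _ e] push_inverse[of i _ "\<not> e"] push_closed in auto)
  then show ?thesis by (simp add: Bij_def)
qed

end

section \<open>Positive elements of an HNN-extension\<close>

locale HNN_group = HNN_pair G I H \<rho> + E: group E
  for G :: "('a, 'm) monoid_scheme" (structure) and I :: "'i set" and H \<rho>
    and E :: "('e, 'n) monoid_scheme" +
  fixes \<psi>
  assumes iso: "\<psi> \<in> iso (HNN_extension G I H \<rho>) E"
begin

definition base :: "'a \<Rightarrow> 'e" where
  "base g = \<psi> (HNN_base G I H \<rho> g)"

definition stable :: "bool \<Rightarrow> 'i \<Rightarrow> 'e" where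
  "stable e i = (let t = \<psi> (HNN_stable G I H \<rho> i) in if e then t else inv\<^bsub>E\<^esub> t)"

lemma \<psi>_hom: "\<psi> \<in> hom (HNN_extension G I H \<rho>) E"
  using iso by (simp add: iso_def)

lemma base_hom: "base \<in> hom G E"
  using Group.hom_compose[OF HNN_base_hom[OF data] \<psi>_hom] by (simp add: base_def[abs_def] o_def)

lemma base_closed: "g \<in> carrier G \<Longrightarrow> base g \<in> carrier E"
  using base_hom by (rule hom_in_carrier)

lemma base_mult: "g \<in> carrier G \<Longrightarrow> h \<in> carrier G \<Longrightarrow> base (g \<otimes> h) = base g \<otimes>\<^bsub>E\<^esub> base h"
  using base_hom by (rule hom_mult)

lemma base_one: "base \<one> = \<one>\<^bsub>E\<^esub>"
  using base_hom by (rule hom_one) (rule is_group, rule E.is_group)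

lemma base_inv: "g \<in> carrier G \<Longrightarrow> base (inv g) = inv\<^bsub>E\<^esub> base g"
  by (metis E.inv_equality base_closed base_mult base_one inv_closed l_inv)

lemma stable_closed: "i \<in> I \<Longrightarrow> stable e i \<in> carrier E"
  using hom_in_carrier[OF \<psi>_hom HNN_stable_closed] by (simp add: stable_def Let_def)

lemma inv_stable: "i \<in> I \<Longrightarrow> inv\<^bsub>E\<^esub> (stable e i) = stable (\<not> e) i"
  using hom_in_carrier[OF \<psi>_hom HNN_stable_closed] by (auto simp: stable_def Let_def)

lemma stable_rel_True:
  assumes "i \<in> I" "h \<in> H i"
  shows "base h \<otimes>\<^bsub>E\<^esub> stable True i = stable True i \<otimes>\<^bsub>E\<^esub> base (\<rho> i h)"
proof -
  have c: "HNN_base G I H \<rho> h \<in> carrier (HNN_extension G I H \<rho>)"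
      "HNN_base G I H \<rho> (\<rho> i h) \<in> carrier (HNN_extension G I H \<rho>)"
    using hom_in_carrier[OF HNN_base_hom[OF data]] HNN_associated_closed[OF data assms] by auto
  have "\<psi> (HNN_base G I H \<rho> h \<otimes>\<^bsub>HNN_extension G I H \<rho>\<^esub> HNN_stable G I H \<rho> i) =
    \<psi> (HNN_stable G I H \<rho> i \<otimes>\<^bsub>HNN_extension G I H \<rho>\<^esub> HNN_base G I H \<rho> (\<rho> i h))"
    using HNN_stable_relation[OF data assms] by simp
  then show ?thesis
    using c HNN_stable_closed[OF assms(1), of G H \<rho>]
    by (simp add: base_def stable_def hom_mult[OF \<psi>_hom])
qed

text \<open>For the inverse letters the relation is obtained from the defining one by conjugation.\<close>

lemma stable_rel:
  assumes i: "i \<in> I" and k: "k \<in> edge_sub e i"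
  shows "stable e i \<otimes>\<^bsub>E\<^esub> base k = base (edge_map e i k) \<otimes>\<^bsub>E\<^esub> stable e i"
proof (cases e)
  case True
  then obtain h where h: "h \<in> H i" "k = \<rho> i h" using k by (auto simp: edge_sub_def)
  then have "edge_map e i k = h" using \<rho>_inj[OF i] True by (simp add: edge_map_def)
  then show ?thesis using stable_rel_True[OF i h(1)] h True by simp
next
  case False
  then have h: "k \<in> H i" using k by (simp add: edge_sub_def)
  have c: "base k \<in> carrier E" "base (\<rho> i k) \<in> carrier E" "stable True i \<in> carrier E"
    using i k False edge_sub_closed[OF i k] edge_map_closed[OF i k]
    by (simp_all add: base_closed stable_closed edge_map_def)
  have "inv\<^bsub>E\<^esub> stable True i \<otimes>\<^bsub>E\<^esub> (base k \<otimes>\<^bsub>E\<^esub> stable True i) = base (\<rho> i k)"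
    using stable_rel_True[OF i h] c by (simp add: E.m_assoc[symmetric])
  then have "inv\<^bsub>E\<^esub> stable True i \<otimes>\<^bsub>E\<^esub> base k = base (\<rho> i k) \<otimes>\<^bsub>E\<^esub> inv\<^bsub>E\<^esub> stable True i"
    using c by (metis E.inv_closed E.inv_solve_right E.m_assoc E.m_closed)
  then show ?thesis using False inv_stable[OF i, of True] by (simp add: edge_map_def)
qed

lemma extend_to_E:
  fixes T :: "('t, 'k) monoid_scheme"
  assumes T: "group T" and f: "f \<in> hom G T" and \<tau>: "\<tau> \<in> I \<rightarrow> carrier T"
    and rel: "\<And>i h. i \<in> I \<Longrightarrow> h \<in> H i \<Longrightarrow> f h \<otimes>\<^bsub>T\<^esub> \<tau> i = \<tau> i \<otimes>\<^bsub>T\<^esub> f (\<rho> i h)"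
  shows "\<exists>\<phi>\<in>hom E T. (\<forall>g\<in>carrier G. \<phi> (base g) = f g) \<and> (\<forall>i\<in>I. \<phi> (stable True i) = \<tau> i)"
proof -
  let ?P = "HNN_extension G I H \<rho>"
  interpret P: group ?P unfolding HNN_extension_def by (rule group_presented_group)
  have "\<exists>\<chi>. \<chi> \<in> hom ?P T \<inter> extensional (carrier ?P) \<and>
      (\<forall>g\<in>carrier G. \<chi> (HNN_base G I H \<rho> g) = f g) \<and> (\<forall>i\<in>I. \<chi> (HNN_stable G I H \<rho> i) = \<tau> i)"
    by (rule ex1_implies_ex, rule HNN_universal[OF data T f \<tau>]) (rule rel)
  then obtain \<chi> where \<chi>: "\<chi> \<in> hom ?P T" "\<And>g. g \<in> carrier G \<Longrightarrow> \<chi> (HNN_base G I H \<rho> g) = f g"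
    "\<And>i. i \<in> I \<Longrightarrow> \<chi> (HNN_stable G I H \<rho> i) = \<tau> i"
    by (elim exE conjE IntE) simp
  define \<eta> where "\<eta> = inv_into (carrier ?P) \<psi>"
  have "\<eta> \<in> hom E ?P" using P.iso_set_sym[OF iso] by (simp add: iso_def \<eta>_def)
  then have "\<chi> \<circ> \<eta> \<in> hom E T" using \<chi>(1) by (rule Group.hom_compose)
  moreover have "\<eta> (\<psi> p) = p" if "p \<in> carrier ?P" for p
    using iso that by (simp add: \<eta>_def iso_def bij_betw_def)
  then have "(\<chi> \<circ> \<eta>) (base g) = f g" if "g \<in> carrier G" for g
    using \<chi>(2) hom_in_carrier[OF HNN_base_hom[OF data] that] that by (simp add: base_def)
  moreover have "(\<chi> \<circ> \<eta>) (stable True i) = \<tau> i" if "i \<in> I" for i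
    using \<chi>(3) HNN_stable_closed[OF that, of G H \<rho>] that \<open>\<And>p. p \<in> carrier ?P \<Longrightarrow> \<eta> (\<psi> p) = p\<close>
    by (simp add: stable_def)
  ultimately show ?thesis by blast
qed

lemma hom_E_eqI:
  fixes T :: "('t, 'k) monoid_scheme"
  assumes T: "group T" and \<phi>: "\<phi>\<^sub>1 \<in> hom E T" "\<phi>\<^sub>2 \<in> hom E T"
    and eq: "\<And>g. g \<in> carrier G \<Longrightarrow> \<phi>\<^sub>1 (base g) = \<phi>\<^sub>2 (base g)"
      "\<And>i. i \<in> I \<Longrightarrow> \<phi>\<^sub>1 (stable True i) = \<phi>\<^sub>2 (stable True i)"
    and x: "x \<in> carrier E"
  shows "\<phi>\<^sub>1 x = \<phi>\<^sub>2 x"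
proof -
  obtain p where p: "p \<in> carrier (HNN_extension G I H \<rho>)" "x = \<psi> p"
    using iso x by (auto simp: iso_def bij_betw_def)
  have "(\<phi>\<^sub>1 \<circ> \<psi>) p = (\<phi>\<^sub>2 \<circ> \<psi>) p"
    by (rule HNN_hom_eqI[OF data T Group.hom_compose[OF \<psi>_hom \<phi>(1)]
          Group.hom_compose[OF \<psi>_hom \<phi>(2)] _ _ p(1)])
      (use eq in \<open>simp_all add: base_def stable_def\<close>)
  then show ?thesis using p by simp
qed

text \<open>Since \<open>left_mult\<close> and \<open>push True\<close> are permutations of the normal forms that satisfy the defining
  relations, they extend to an action of \<open>E\<close>. That \<open>t\<^sub>i\<inverse>\<close> acts as \<open>push False\<close> follows because
  the two pushes are mutually inverse.\<close>

lemma normal_form_action: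
  obtains \<alpha> :: "'e \<Rightarrow> 'a \<times> (bool \<times> 'i \<times> 'a) list \<Rightarrow> 'a \<times> (bool \<times> 'i \<times> 'a) list"
  where "\<And>x y n. x \<in> carrier E \<Longrightarrow> y \<in> carrier E \<Longrightarrow> n \<in> normal_forms \<Longrightarrow> \<alpha> (x \<otimes>\<^bsub>E\<^esub> y) n = \<alpha> x (\<alpha> y n)"
    "\<And>x n. x \<in> carrier E \<Longrightarrow> n \<in> normal_forms \<Longrightarrow> \<alpha> x n \<in> normal_forms"
    "\<And>g n. g \<in> carrier G \<Longrightarrow> n \<in> normal_forms \<Longrightarrow> \<alpha> (base g) n = left_mult g n"
    "\<And>e i n. i \<in> I \<Longrightarrow> n \<in> normal_forms \<Longrightarrow> \<alpha> (stable e i) n = push e i n"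
proof -
  let ?B = "BijGroup normal_forms"
  have cB: "carrier ?B = Bij normal_forms" by (simp add: BijGroup_def)
  have mB: "(a \<otimes>\<^bsub>?B\<^esub> b) = compose normal_forms a b"
    if "a \<in> Bij normal_forms" "b \<in> Bij normal_forms" for a b
    using that by (simp add: BijGroup_def)
  define f where "f = (\<lambda>g. restrict (left_mult g) normal_forms)"
  define \<tau> where "\<tau> = (\<lambda>i. restrict (push True i) normal_forms)"
  have fB: "f g \<in> Bij normal_forms" if "g \<in> carrier G" for g
    using left_mult_in_Bij[OF that] by (simp add: f_def)
  have \<tau>B: "\<tau> i \<in> Bij normal_forms" if "i \<in> I" for i
    using push_in_Bij[OF that] by (simp add: \<tau>_def)
  have left_mult_closed: "left_mult g n \<in> normal_forms" if "g \<in> carrier G" "n \<in> normal_forms" for g n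
    using that by (cases n) (simp add: left_mult_def normal_forms_def)
  have left_mult_one: "left_mult \<one> n = n" if "n \<in> normal_forms" for n
    using that by (cases n) (simp add: left_mult_def normal_forms_def)
  have f: "f \<in> hom G ?B"
  proof (rule homI)
    fix x y assume xy: "x \<in> carrier G" "y \<in> carrier G"
    have "left_mult (x \<otimes> y) n = left_mult x (left_mult y n)" if "n \<in> normal_forms" for n
      using that xy by (cases n) (simp add: left_mult_def normal_forms_def m_assoc)
    then show "f (x \<otimes> y) = f x \<otimes>\<^bsub>?B\<^esub> f y"
      using xy by (simp add: mB fB) (simp add: f_def compose_def left_mult_closed cong: restrict_cong)
  qed (simp add: cB fB)
  have "\<exists>\<alpha>\<in>hom E ?B. (\<forall>g\<in>carrier G. \<alpha> (base g) = f g) \<and> (\<forall>i\<in>I. \<alpha> (stable True i) = \<tau> i)"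
  proof (rule extend_to_E[OF group_BijGroup f])
    show "\<tau> \<in> I \<rightarrow> carrier ?B" using \<tau>B by (simp add: cB)
    fix i h assume i: "i \<in> I" and h: "h \<in> H i"
    have k: "\<rho> i h \<in> edge_sub True i" "edge_map True i (\<rho> i h) = h"
      using h \<rho>_inj[OF i] by (simp_all add: edge_sub_def edge_map_def)
    have hG: "h \<in> carrier G" "\<rho> i h \<in> carrier G"
      using edge_sub_closed[OF i, of h False] edge_sub_closed[OF i k(1)] h
      by (simp_all add: edge_sub_def)
    have "push True i (left_mult (\<rho> i h) n) = left_mult h (push True i n)"
      if n: "n \<in> normal_forms" for n
    proof -
      obtain g L where gL: "n = (g, L)" "g \<in> carrier G" using n by (auto simp: normal_forms_def)
      show ?thesis
        using push_mult[OF i k(1) gL(2) n[unfolded gL(1)]]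
        unfolding gL(1) k(2) left_mult_def apfst_conv .
    qed
    then show "f h \<otimes>\<^bsub>?B\<^esub> \<tau> i = \<tau> i \<otimes>\<^bsub>?B\<^esub> f (\<rho> i h)"
      using hG i push_closed[OF i]
      by (simp add: mB fB \<tau>B)
        (simp add: f_def \<tau>_def compose_def left_mult_closed cong: restrict_cong)
  qed
  then obtain \<alpha> where \<alpha>: "\<alpha> \<in> hom E ?B" "\<And>g. g \<in> carrier G \<Longrightarrow> \<alpha> (base g) = f g"
    "\<And>i. i \<in> I \<Longrightarrow> \<alpha> (stable True i) = \<tau> i"
    by auto
  have \<alpha>B: "\<alpha> x \<in> Bij normal_forms" if "x \<in> carrier E" for x
    using hom_in_carrier[OF \<alpha>(1) that] by (simp add: cB)
  show thesis
  proof
    show mult: "\<alpha> (x \<otimes>\<^bsub>E\<^esub> y) n = \<alpha> x (\<alpha> y n)"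
      if "x \<in> carrier E" "y \<in> carrier E" "n \<in> normal_forms" for x y n
      using that by (simp add: hom_mult[OF \<alpha>(1)] mB \<alpha>B compose_def)
    show "\<alpha> x n \<in> normal_forms" if "x \<in> carrier E" "n \<in> normal_forms" for x n
      using Bij_imp_funcset[OF \<alpha>B] that by blast
    show base: "\<alpha> (base g) n = left_mult g n" if "g \<in> carrier G" "n \<in> normal_forms" for g n
      using that by (simp add: \<alpha> f_def)
    show "\<alpha> (stable e i) n = push e i n" if i: "i \<in> I" and n: "n \<in> normal_forms" for e i n
    proof (cases e)
      case True
      then show ?thesis using that by (simp add: \<alpha> \<tau>_def)
    next
      case False
      let ?m = "push False i n"
      have m: "?m \<in> normal_forms" "push True i ?m = n"
        using push_closed[OF i n] push_inverse[OF i n, of False] by simp_all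
      then have n': "\<alpha> (stable True i) ?m = n" using i by (simp add: \<alpha> \<tau>_def)
      have one: "stable False i \<otimes>\<^bsub>E\<^esub> stable True i = base \<one>"
        unfolding base_one using E.l_inv[OF stable_closed[OF i, of True]]
        unfolding inv_stable[OF i] by simp
      have "\<alpha> (stable False i) n = \<alpha> (stable False i) (\<alpha> (stable True i) ?m)"
        unfolding n' ..
      also have "\<dots> = \<alpha> (base \<one>) ?m"
        unfolding one[symmetric] mult[OF stable_closed[OF i] stable_closed[OF i] m(1)] ..
      also have "\<dots> = ?m"
        unfolding base[OF one_closed m(1)] using m(1) by (rule left_mult_one)
      finally show ?thesis using False by simp
    qed
  qed
qed

text \<open>The properties of the orbit map \<open>x \<mapsto> x \<cdot> (\<one>, [])\<close> that are used below; they determine it.\<close>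

definition is_normal_form_map :: "('e \<Rightarrow> 'a \<times> (bool \<times> 'i \<times> 'a) list) \<Rightarrow> bool" where
  "is_normal_form_map \<nu> \<longleftrightarrow>
     \<nu> \<one>\<^bsub>E\<^esub> = (\<one>, []) \<and>
     (\<forall>g\<in>carrier G. \<forall>x\<in>carrier E. \<nu> (base g \<otimes>\<^bsub>E\<^esub> x) = left_mult g (\<nu> x)) \<and>
     (\<forall>e. \<forall>i\<in>I. \<forall>x\<in>carrier E. \<nu> (stable e i \<otimes>\<^bsub>E\<^esub> x) = push e i (\<nu> x))"

lemma ex_normal_form_map: "\<exists>\<nu>. is_normal_form_map \<nu>"
proof -
  obtain \<alpha> where mult: "\<And>x y n. x \<in> carrier E \<Longrightarrow> y \<in> carrier E \<Longrightarrow> n \<in> normal_forms \<Longrightarrow> \<alpha> (x \<otimes>\<^bsub>E\<^esub> y) n = \<alpha> x (\<alpha> y n)"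
    and closed: "\<And>x n. x \<in> carrier E \<Longrightarrow> n \<in> normal_forms \<Longrightarrow> \<alpha> x n \<in> normal_forms"
    and base: "\<And>g n. g \<in> carrier G \<Longrightarrow> n \<in> normal_forms \<Longrightarrow> \<alpha> (base g) n = left_mult g n"
    and stable: "\<And>e i n. i \<in> I \<Longrightarrow> n \<in> normal_forms \<Longrightarrow> \<alpha> (stable e i) n = push e i n"
    by (rule normal_form_action, rule that) assumption+
  have nf: "(\<one>, []) \<in> normal_forms" by (simp add: normal_forms_def)
  have "\<alpha> \<one>\<^bsub>E\<^esub> (\<one>, []) = (\<one>, [])"
    using base[OF one_closed nf] by (simp add: base_one left_mult_def)
  then have "is_normal_form_map (\<lambda>x. \<alpha> x (\<one>, []))"
    unfolding is_normal_form_map_def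
    by (auto simp: nf mult closed base stable base_closed stable_closed)
  then show ?thesis by blast
qed

definition normal_form :: "'e \<Rightarrow> 'a \<times> (bool \<times> 'i \<times> 'a) list" where
  "normal_form = (SOME \<nu>. is_normal_form_map \<nu>)"

lemma normal_form:
  "normal_form \<one>\<^bsub>E\<^esub> = (\<one>, [])"
  "g \<in> carrier G \<Longrightarrow> x \<in> carrier E \<Longrightarrow> normal_form (base g \<otimes>\<^bsub>E\<^esub> x) = left_mult g (normal_form x)"
  "i \<in> I \<Longrightarrow> x \<in> carrier E \<Longrightarrow> normal_form (stable e i \<otimes>\<^bsub>E\<^esub> x) = push e i (normal_form x)"
proof -
  have "is_normal_form_map normal_form"
    unfolding normal_form_def using ex_normal_form_map by (rule someI_ex)
  then show "normal_form \<one>\<^bsub>E\<^esub> = (\<one>, [])"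
    "g \<in> carrier G \<Longrightarrow> x \<in> carrier E \<Longrightarrow> normal_form (base g \<otimes>\<^bsub>E\<^esub> x) = left_mult g (normal_form x)"
    "i \<in> I \<Longrightarrow> x \<in> carrier E \<Longrightarrow> normal_form (stable e i \<otimes>\<^bsub>E\<^esub> x) = push e i (normal_form x)"
    by (auto simp: is_normal_form_map_def)
qed

text \<open>Products with \<open>n\<close> letters, all of sign \<open>e\<close>. The index \<open>n\<close> belongs to a factorization; that it is
  determined by the element is \<open>positive_degree_unique\<close>.\<close>

inductive positive :: "bool \<Rightarrow> nat \<Rightarrow> 'e \<Rightarrow> bool" for e where
  base: "g \<in> carrier G \<Longrightarrow> positive e 0 (base g)"
| stable: "g \<in> carrier G \<Longrightarrow> i \<in> I \<Longrightarrow> positive e n x \<Longrightarrow>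
    positive e (Suc n) (base g \<otimes>\<^bsub>E\<^esub> (stable e i \<otimes>\<^bsub>E\<^esub> x))"

lemma positive_closed: "positive e n x \<Longrightarrow> x \<in> carrier E"
  by (induction rule: positive.induct) (auto simp: base_closed stable_closed)

lemma positive_one: "positive e 0 \<one>\<^bsub>E\<^esub>"
  using positive.base[OF one_closed] by (simp add: base_one)

lemma positive_base_mult:
  assumes "positive e n x" and h: "h \<in> carrier G"
  shows "positive e n (base h \<otimes>\<^bsub>E\<^esub> x)"
  using assms(1)
proof cases
  case (base g)
  then show ?thesis using positive.base[of "h \<otimes> g" e] h by (simp add: base_mult)
next
  case (stable g i m y)
  then show ?thesis
    using positive.stable[of "h \<otimes> g" i e m y] h positive_closed[OF stable(5)]
    by (simp add: base_mult base_closed stable_closed E.m_assoc)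
qed

lemma positive_mult:
  assumes "positive e n x" and y: "positive e m y"
  shows "positive e (n + m) (x \<otimes>\<^bsub>E\<^esub> y)"
  using assms(1)
proof induction
  case (base g)
  then show ?case using positive_base_mult[OF y] by simp
next
  case (stable g i n x)
  then show ?case
    using positive.stable[OF stable(1,2,4)] positive_closed[OF y] positive_closed[OF stable(3)]
    by (simp add: base_closed stable_closed E.m_assoc)
qed

lemma positive_stable: "i \<in> I \<Longrightarrow> positive e 1 (stable e i)"
  using positive.stable[OF one_closed _ positive_one[of e], of i] by (simp add: base_one stable_closed)

text \<open>Inversion exchanges the two signs, which is how statements about left multiples become statements
  about right multiples.\<close>

lemma positive_inv: "positive e n x \<Longrightarrow> positive (\<not> e) n (inv\<^bsub>E\<^esub> x)"
proof (induction rule: positive.induct)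
  case (base g)
  then show ?case using positive.base[of "inv g" "\<not> e"] by (simp add: base_inv)
next
  case (stable g i n x)
  have "positive (\<not> e) (n + 1 + 0) (inv\<^bsub>E\<^esub> x \<otimes>\<^bsub>E\<^esub> stable (\<not> e) i \<otimes>\<^bsub>E\<^esub> base (inv g))"
    using stable by (intro positive_mult positive_stable positive.base inv_closed)
  then show ?case
    using stable(1,2) positive_closed[OF stable(3)]
    by (simp add: E.inv_mult_group base_closed stable_closed inv_stable base_inv E.m_assoc)
qed

lemma push_same_sign:
  assumes "\<not> starts (\<not> e) i L"
  shows "push e i (g, L) = (edge_map e i (g \<otimes> inv (coset_rep (edge_sub e i) g)),
      (e, i, coset_rep (edge_sub e i) g) # L)"
  using assms by (simp add: push_def Let_def)

text \<open>Letters of equal sign never cancel, so every letter of the product survives in the normal form.\<close>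

lemma normal_form_positive:
  assumes "positive e n x"
  shows "\<exists>g L. normal_form x = (g, L) \<and> g \<in> carrier G \<and> length L = n \<and> (\<forall>i. \<not> starts (\<not> e) i L)"
  using assms
proof induction
  case (base g)
  then show ?case using normal_form(2)[OF base E.one_closed]
    by (simp add: normal_form(1) left_mult_def base_closed starts_def)
next
  case (stable g i n x)
  then obtain h L where L: "normal_form x = (h, L)" "h \<in> carrier G" "length L = n"
      "\<And>i. \<not> starts (\<not> e) i L" by blast
  have "edge_map e i (h \<otimes> inv (coset_rep (edge_sub e i) h)) \<in> carrier G"
    using edge_map_closed coset_rep_factor subgroup_edge_sub L(2) stable(2) by blast
  then show ?case
    using stable(1,2) positive_closed[OF stable(3)] L
    by (simp add: normal_form stable_closed push_same_sign left_mult_def starts_def)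
qed

lemma positive_degree_unique: "positive e n x \<Longrightarrow> positive e m x \<Longrightarrow> n = m"
  using normal_form_positive[of e n x] normal_form_positive[of e m x] by auto

text \<open>Both sides have normal forms whose first letter and tail can be compared: they agree in the
  letter, and their coefficients \<open>g k\<close> and \<open>l\<close> have \<open>k\<close> and \<open>l\<close> in the same associated subgroup.\<close>

lemma positive_first_letter:
  assumes x: "positive e n x" and y: "positive e m y" and g: "g \<in> carrier G"
    and i: "i \<in> I" and j: "j \<in> I"
    and eq: "base g \<otimes>\<^bsub>E\<^esub> (stable e i \<otimes>\<^bsub>E\<^esub> x) = stable e j \<otimes>\<^bsub>E\<^esub> y"
  shows "i = j \<and> g \<in> edge_sub (\<not> e) i"
proof -
  obtain a L where a: "normal_form x = (a, L)" "a \<in> carrier G" "\<And>i. \<not> starts (\<not> e) i L"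
    using normal_form_positive[OF x] by blast
  obtain b L' where b: "normal_form y = (b, L')" "b \<in> carrier G" "\<And>i. \<not> starts (\<not> e) i L'"
    using normal_form_positive[OF y] by blast
  define k where "k = edge_map e i (a \<otimes> inv (coset_rep (edge_sub e i) a))"
  define l where "l = edge_map e j (b \<otimes> inv (coset_rep (edge_sub e j) b))"
  have k: "k \<in> edge_sub (\<not> e) i" and l: "l \<in> edge_sub (\<not> e) j"
    unfolding k_def l_def using i j a(2) b(2)
    by (auto intro!: edge_map_in coset_rep_factor subgroup_edge_sub)
  have "left_mult g (push e i (a, L)) = push e j (b, L')"
    using arg_cong[OF eq, of normal_form] g i j positive_closed[OF x] positive_closed[OF y]
    by (simp add: normal_form stable_closed a b)
  then have "(g \<otimes> k, (e, i, coset_rep (edge_sub e i) a) # L) = (l, (e, j, coset_rep (edge_sub e j) b) # L')"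
    unfolding push_same_sign[OF a(3)] push_same_sign[OF b(3)] left_mult_def apfst_conv k_def l_def .
  then have ij: "i = j" and gk: "g \<otimes> k = l" by simp_all
  have "g = l \<otimes> inv k"
    using gk g edge_sub_closed[OF i k] by (auto simp: m_assoc)
  moreover have "l \<otimes> inv k \<in> edge_sub (\<not> e) i"
    using k l ij subgroup_edge_sub[OF i] by (simp add: subgroup.m_closed subgroup.m_inv_closed)
  ultimately show ?thesis using ij by simp
qed

text \<open>Induction on the letters of \<open>a\<close>: strip the common first letter of \<open>a\<close> and \<open>b\<close>, moving the unit
  between them to the other side of that letter.\<close>

lemma positive_rigid:
  assumes "positive e n a" "positive e m b" "positive e p x" "positive e q y"
    and "a \<otimes>\<^bsub>E\<^esub> x = b \<otimes>\<^bsub>E\<^esub> y" "n \<le> m"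
  shows "\<exists>r z. positive e r z \<and> b = a \<otimes>\<^bsub>E\<^esub> z"
  using assms
proof (induction arbitrary: m b p x rule: positive.induct)
  case (base g)
  have "b = base g \<otimes>\<^bsub>E\<^esub> (base (inv g) \<otimes>\<^bsub>E\<^esub> b)"
    using base(1) positive_closed[OF base(2)]
    by (simp add: base_inv base_closed E.m_assoc[symmetric])
  then show ?case using positive_base_mult[OF base(2), of "inv g"] base(1) by blast
next
  case (stable g i n a)
  from stable.prems(1) show ?case
  proof cases
    case (base g')
    then show ?thesis using stable.prems by simp
  next
    case b: (stable g' j m' b')
    note [simp] = base_closed stable_closed
    have [simp]: "a \<in> carrier E" "b' \<in> carrier E" "x \<in> carrier E" "y \<in> carrier E"
      using positive_closed stable.hyps(3) b(5) stable.prems(2,3) by auto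
    note [simp] = stable.hyps(1,2) b(3,4)
    \<comment> \<open>The first letters agree up to \<open>h\<close>, and \<open>h\<close> moves past the letter as \<open>k\<close>.\<close>
    define h where "h = inv g' \<otimes> g"
    have h: "h \<in> carrier G" by (simp add: h_def)
    have ax: "positive e (n + p) (a \<otimes>\<^bsub>E\<^esub> x)" and b'y: "positive e (m' + q) (b' \<otimes>\<^bsub>E\<^esub> y)"
      using positive_mult stable.hyps(3) b(5) stable.prems(2,3) by auto
    have eq: "base g \<otimes>\<^bsub>E\<^esub> (stable e i \<otimes>\<^bsub>E\<^esub> (a \<otimes>\<^bsub>E\<^esub> x)) = base g' \<otimes>\<^bsub>E\<^esub> (stable e j \<otimes>\<^bsub>E\<^esub> (b' \<otimes>\<^bsub>E\<^esub> y))"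
      using stable.prems(4) b(2) by (simp add: E.m_assoc)
    have "base h \<otimes>\<^bsub>E\<^esub> (stable e i \<otimes>\<^bsub>E\<^esub> (a \<otimes>\<^bsub>E\<^esub> x)) =
        inv\<^bsub>E\<^esub> base g' \<otimes>\<^bsub>E\<^esub> (base g \<otimes>\<^bsub>E\<^esub> (stable e i \<otimes>\<^bsub>E\<^esub> (a \<otimes>\<^bsub>E\<^esub> x)))"
      by (simp add: h_def base_mult base_inv E.m_assoc)
    also have "\<dots> = stable e j \<otimes>\<^bsub>E\<^esub> (b' \<otimes>\<^bsub>E\<^esub> y)"
      unfolding eq by (simp add: E.m_assoc[symmetric])
    finally have eq': "base h \<otimes>\<^bsub>E\<^esub> (stable e i \<otimes>\<^bsub>E\<^esub> (a \<otimes>\<^bsub>E\<^esub> x)) = stable e j \<otimes>\<^bsub>E\<^esub> (b' \<otimes>\<^bsub>E\<^esub> y)" .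
    have ij: "i = j" and hi: "h \<in> edge_sub (\<not> e) i"
      using positive_first_letter[OF ax b'y h _ _ eq'] by auto
    define k where "k = edge_map (\<not> e) i h"
    have k: "k \<in> edge_sub e i" "k \<in> carrier G" "edge_map e i k = h"
      using hi edge_map_in[of i h "\<not> e"] edge_map_closed[of i h "\<not> e"] edge_map_inverse[of i h "\<not> e"]
      by (simp_all add: k_def)
    have hk: "base h \<otimes>\<^bsub>E\<^esub> stable e i = stable e i \<otimes>\<^bsub>E\<^esub> base k"
      using stable_rel[of i k e] k by simp
    have "stable e i \<otimes>\<^bsub>E\<^esub> (base k \<otimes>\<^bsub>E\<^esub> (a \<otimes>\<^bsub>E\<^esub> x)) = stable e i \<otimes>\<^bsub>E\<^esub> (b' \<otimes>\<^bsub>E\<^esub> y)"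
      using eq' hk h k ij by (simp add: E.m_assoc[symmetric])
    then have eq2: "base k \<otimes>\<^bsub>E\<^esub> (a \<otimes>\<^bsub>E\<^esub> x) = b' \<otimes>\<^bsub>E\<^esub> y"
      using k by simp
    have "a \<otimes>\<^bsub>E\<^esub> x = inv\<^bsub>E\<^esub> base k \<otimes>\<^bsub>E\<^esub> (base k \<otimes>\<^bsub>E\<^esub> (a \<otimes>\<^bsub>E\<^esub> x))"
      using k by (simp add: E.m_assoc[symmetric])
    also have "\<dots> = base (inv k) \<otimes>\<^bsub>E\<^esub> b' \<otimes>\<^bsub>E\<^esub> y"
      unfolding eq2 using k by (simp add: base_inv E.m_assoc)
    finally have "a \<otimes>\<^bsub>E\<^esub> x = base (inv k) \<otimes>\<^bsub>E\<^esub> b' \<otimes>\<^bsub>E\<^esub> y" .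
    moreover have "positive e m' (base (inv k) \<otimes>\<^bsub>E\<^esub> b')"
      using b(5) k by (simp add: positive_base_mult)
    ultimately obtain r z where z: "positive e r z" "base (inv k) \<otimes>\<^bsub>E\<^esub> b' = a \<otimes>\<^bsub>E\<^esub> z"
      using stable.IH[of m' "base (inv k) \<otimes>\<^bsub>E\<^esub> b'" p x] stable.prems b(1) by auto
    note [simp] = positive_closed[OF z(1)]
    have b': "b' = base k \<otimes>\<^bsub>E\<^esub> (a \<otimes>\<^bsub>E\<^esub> z)"
      unfolding z(2)[symmetric] using k by (simp add: base_inv E.m_assoc[symmetric])
    have "b = base g' \<otimes>\<^bsub>E\<^esub> (stable e i \<otimes>\<^bsub>E\<^esub> base k) \<otimes>\<^bsub>E\<^esub> (a \<otimes>\<^bsub>E\<^esub> z)"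
      unfolding b(2) b' using ij k by (simp add: E.m_assoc)
    also have "\<dots> = (base g' \<otimes>\<^bsub>E\<^esub> base h) \<otimes>\<^bsub>E\<^esub> (stable e i \<otimes>\<^bsub>E\<^esub> (a \<otimes>\<^bsub>E\<^esub> z))"
      unfolding hk[symmetric] using h by (simp add: E.m_assoc)
    also have "base g' \<otimes>\<^bsub>E\<^esub> base h = base g"
      by (simp add: h_def base_mult base_inv E.m_assoc[symmetric])
    also have "base g \<otimes>\<^bsub>E\<^esub> (stable e i \<otimes>\<^bsub>E\<^esub> (a \<otimes>\<^bsub>E\<^esub> z)) = base g \<otimes>\<^bsub>E\<^esub> (stable e i \<otimes>\<^bsub>E\<^esub> a) \<otimes>\<^bsub>E\<^esub> z"
      by (simp add: E.m_assoc)
    finally show ?thesis using z(1) by blast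
  qed
qed

end

section \<open>A sufficient condition for Rees monoids\<close>

text \<open>All principal right ideals above \<open>a\<close> contain \<open>a\<close>, so by rigidity they form a chain in which the
  degree of a generator determines the ideal; as these degrees are at most \<open>deg a\<close>, there are only
  finitely many.\<close>

lemma left_rees_monoidI:
  fixes M :: "('a, 'm) monoid_scheme" (structure)
  assumes M: "monoid M" and canc: "left_cancellative M"
    and deg_mult: "\<And>a b. a \<in> carrier M \<Longrightarrow> b \<in> carrier M \<Longrightarrow> deg (a \<otimes> b) = (deg a + deg b :: nat)"
    and deg_zero: "\<And>a. a \<in> carrier M \<Longrightarrow> deg a = 0 \<Longrightarrow> a \<in> Units M"
    and nontrivial: "\<exists>a\<in>carrier M. deg a \<noteq> 0"
    and rigid: "\<And>a b x y. a \<in> carrier M \<Longrightarrow> b \<in> carrier M \<Longrightarrow> x \<in> carrier M \<Longrightarrow> y \<in> carrier M \<Longrightarrow>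
      a \<otimes> x = b \<otimes> y \<Longrightarrow> deg a \<le> deg b \<Longrightarrow> \<exists>z\<in>carrier M. b = a \<otimes> z"
  shows "left_rees_monoid M"
proof -
  interpret monoid M by fact
  have ideal_iff: "x \<in> principal_right_ideal M a \<longleftrightarrow> (\<exists>y\<in>carrier M. x = a \<otimes> y)" for x a
    by (auto simp: l_coset_def)
  have ideal_subset: "principal_right_ideal M (a \<otimes> z) \<subseteq> principal_right_ideal M a"
    if "a \<in> carrier M" "z \<in> carrier M" for a z
  proof
    fix x assume "x \<in> principal_right_ideal M (a \<otimes> z)"
    then obtain y where "y \<in> carrier M" "x = a \<otimes> z \<otimes> y" unfolding ideal_iff by blast
    then have "z \<otimes> y \<in> carrier M" "x = a \<otimes> (z \<otimes> y)" using that by (simp_all add: m_assoc)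
    then show "x \<in> principal_right_ideal M a" unfolding ideal_iff by blast
  qed
  have self: "a \<in> principal_right_ideal M a" if "a \<in> carrier M" for a
    using that by (auto simp: ideal_iff intro!: bexI[of _ \<one>])
  have ideals_le: "principal_right_ideal M b \<subseteq> principal_right_ideal M a"
    if ab: "a \<in> carrier M" "b \<in> carrier M" "deg a \<le> deg b"
      and c: "c \<in> principal_right_ideal M a" "c \<in> principal_right_ideal M b" for a b c
  proof -
    obtain x y where xy: "x \<in> carrier M" "y \<in> carrier M" "c = a \<otimes> x" "c = b \<otimes> y"
      using c unfolding ideal_iff by blast
    then obtain z where "z \<in> carrier M" "b = a \<otimes> z"
      using rigid[OF ab(1,2) xy(1,2) _ ab(3)] by auto
    then show ?thesis using ideal_subset[OF ab(1)] by simp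
  qed
  have "right_rigid M"
    unfolding right_rigid_def
  proof (intro ballI impI)
    fix a b assume ab: "a \<in> carrier M" "b \<in> carrier M"
      and "principal_right_ideal M a \<inter> principal_right_ideal M b \<noteq> {}"
    then obtain c where "c \<in> principal_right_ideal M a" "c \<in> principal_right_ideal M b" by blast
    then show "principal_right_ideal M a \<subseteq> principal_right_ideal M b \<or>
        principal_right_ideal M b \<subseteq> principal_right_ideal M a"
      using ideals_le[OF ab] ideals_le[OF ab(2,1)] nat_le_linear[of "deg a" "deg b"] by blast
  qed
  moreover have "finite {J \<in> principal_right_ideal M ` carrier M. principal_right_ideal M a \<subset> J}"
    (is "finite ?A") if a: "a \<in> carrier M" for a
  proof -
    have "\<exists>b. b \<in> carrier M \<and> J = principal_right_ideal M b \<and> a \<in> J" if "J \<in> ?A" for J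
      using self[OF a] that by blast
    then obtain gen where gen: "\<And>J. J \<in> ?A \<Longrightarrow>
        gen J \<in> carrier M \<and> J = principal_right_ideal M (gen J) \<and> a \<in> J"
      by metis
    show ?thesis
    proof (rule inj_on_finite)
      show "inj_on (deg \<circ> gen) ?A"
      proof (rule inj_onI)
        fix J K assume J: "J \<in> ?A" and K: "K \<in> ?A" and eq: "(deg \<circ> gen) J = (deg \<circ> gen) K"
        have "principal_right_ideal M (gen J) = principal_right_ideal M (gen K)"
          using gen[OF J] gen[OF K] eq
          by (intro subset_antisym ideals_le[of _ _ a]) auto
        then show "J = K" using gen[OF J] gen[OF K] by simp
      qed
      show "(deg \<circ> gen) ` ?A \<subseteq> {..deg a}"
      proof
        fix d assume "d \<in> (deg \<circ> gen) ` ?A"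
        then obtain J where J: "J \<in> ?A" "d = deg (gen J)" by auto
        then have "gen J \<in> carrier M" and "a \<in> principal_right_ideal M (gen J)"
          using gen[OF J(1)] by auto
        then obtain y where "gen J \<in> carrier M" "y \<in> carrier M" "a = gen J \<otimes> y"
          unfolding ideal_iff by blast
        then show "d \<in> {..deg a}" using J(2) by (simp add: deg_mult)
      qed
    qed simp
  qed
  moreover have "\<not> group M"
  proof
    assume "group M"
    then interpret group M .
    obtain a where a: "a \<in> carrier M" "deg a \<noteq> 0" using nontrivial by blast
    have "deg \<one> = 0" using deg_mult[of \<one> \<one>] by simp
    then show False using deg_mult[of a "inv a"] a by simp
  qed
  ultimately show ?thesis using M canc by (simp add: left_rees_monoid_def)
qed

definition opposite_monoid :: "('a, 'm) monoid_scheme \<Rightarrow> 'a monoid" where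
  "opposite_monoid M = \<lparr>carrier = carrier M, mult = (\<lambda>a b. b \<otimes>\<^bsub>M\<^esub> a), one = \<one>\<^bsub>M\<^esub>\<rparr>"

lemma opposite_monoid_simps [simp]:
  "carrier (opposite_monoid M) = carrier M"
  "a \<otimes>\<^bsub>opposite_monoid M\<^esub> b = b \<otimes>\<^bsub>M\<^esub> a"
  "\<one>\<^bsub>opposite_monoid M\<^esub> = \<one>\<^bsub>M\<^esub>"
  by (simp_all add: opposite_monoid_def)

lemma monoid_opposite: "monoid M \<Longrightarrow> monoid (opposite_monoid M)"
  by (rule monoidI) (auto simp: monoid.m_closed monoid.one_closed monoid.m_assoc monoid.l_one monoid.r_one)

lemma Units_opposite: "Units (opposite_monoid M) = Units M"
  by (auto simp: Units_def)

lemma right_rees_opposite: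
  assumes M: "monoid M" and "left_rees_monoid (opposite_monoid M)"
  shows "right_rees_monoid M"
proof -
  have ideal: "principal_right_ideal (opposite_monoid M) a = principal_left_ideal M a" for a
    by (simp add: l_coset_def r_coset_def)
  have "\<not> group M"
  proof
    assume "group M"
    then have "group (opposite_monoid M)"
      using monoid_opposite[OF M] by (simp add: group_def group_axioms_def Units_opposite)
    then show False using assms(2) by (simp add: left_rees_monoid_def)
  qed
  then show ?thesis
    using assms unfolding left_rees_monoid_def right_rees_monoid_def
      left_cancellative_def right_cancellative_def right_rigid_def left_rigid_def ideal
    by simp
qed

section \<open>The Rees monoid of positive elements\<close>

context HNN_group
begin

definition positive_monoid :: "'e monoid" where
  "positive_monoid = \<lparr>carrier = {x. \<exists>n. positive True n x}, mult = mult E, one = one E\<rparr>"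

lemma positive_monoid_simps [simp]:
  "x \<in> carrier positive_monoid \<longleftrightarrow> (\<exists>n. positive True n x)"
  "x \<otimes>\<^bsub>positive_monoid\<^esub> y = x \<otimes>\<^bsub>E\<^esub> y"
  "\<one>\<^bsub>positive_monoid\<^esub> = \<one>\<^bsub>E\<^esub>"
  by (simp_all add: positive_monoid_def)

lemma monoid_positive: "monoid positive_monoid"
  by (rule monoidI)
    (auto intro: positive_mult positive_one simp: positive_closed E.m_assoc)

definition degree :: "'e \<Rightarrow> nat" where
  "degree x = (THE n. positive True n x)"

lemma degree_eq: "positive True n x \<Longrightarrow> degree x = n"
  unfolding degree_def by (blast intro: positive_degree_unique)

lemma positive_zero_Units:
  assumes "positive True 0 x"
  shows "x \<in> Units positive_monoid"
proof -
  obtain g where g: "g \<in> carrier G" "x = base g"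
    using assms by cases
  then have "base (inv g) \<in> carrier positive_monoid" "base (inv g) \<otimes>\<^bsub>E\<^esub> x = \<one>\<^bsub>E\<^esub>"
    "x \<otimes>\<^bsub>E\<^esub> base (inv g) = \<one>\<^bsub>E\<^esub>"
    using positive.base[of "inv g" True] by (auto simp: base_inv base_closed)
  moreover have "x \<in> carrier positive_monoid" using assms by auto
  ultimately show ?thesis unfolding Units_def positive_monoid_simps(2,3) by blast
qed

lemma ex_degree_nonzero: "\<exists>a\<in>carrier positive_monoid. degree a \<noteq> 0"
proof -
  obtain i where "i \<in> I" using data by (auto simp: HNN_data_def)
  then have "positive True 1 (stable True i)" by (rule positive_stable)
  then show ?thesis
    using degree_eq[of 1 "stable True i"] by (intro bexI[of _ "stable True i"]) auto
qed

lemma degree_mult: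
  "a \<in> carrier positive_monoid \<Longrightarrow> b \<in> carrier positive_monoid \<Longrightarrow>
    degree (a \<otimes>\<^bsub>E\<^esub> b) = degree a + degree b"
  by (auto simp: degree_eq dest: positive_mult[THEN degree_eq])

lemma positive_left_rees: "left_rees_monoid positive_monoid"
proof (rule left_rees_monoidI[where deg = degree])
  show "left_cancellative positive_monoid"
    by (auto simp: left_cancellative_def positive_closed)
  fix a b x y assume *: "a \<in> carrier positive_monoid" "b \<in> carrier positive_monoid"
    "x \<in> carrier positive_monoid" "y \<in> carrier positive_monoid"
    "a \<otimes>\<^bsub>positive_monoid\<^esub> x = b \<otimes>\<^bsub>positive_monoid\<^esub> y" "degree a \<le> degree b"
  then obtain n m p q where "positive True n a" "positive True m b" "positive True p x" "positive True q y"
    by auto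
  then show "\<exists>z\<in>carrier positive_monoid. b = a \<otimes>\<^bsub>positive_monoid\<^esub> z"
    using positive_rigid[of True n a m b p x q y] * by (auto simp: degree_eq Bex_def)
qed (use monoid_positive degree_mult ex_degree_nonzero positive_zero_Units in \<open>auto simp: degree_eq\<close>)

text \<open>An equation \<open>x a = y b\<close> between positive elements becomes \<open>a\<inverse> x\<inverse> = b\<inverse> y\<inverse>\<close> between elements
  of negative sign, to which \<open>positive_rigid\<close> applies.\<close>

lemma positive_right_rees: "right_rees_monoid positive_monoid"
proof (rule right_rees_opposite[OF monoid_positive], rule left_rees_monoidI[where deg = degree])
  let ?O = "opposite_monoid positive_monoid"
  show "left_cancellative ?O"
    by (auto simp: left_cancellative_def positive_closed)
  show "\<exists>z\<in>carrier ?O. b = a \<otimes>\<^bsub>?O\<^esub> z"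
    if *: "a \<in> carrier ?O" "b \<in> carrier ?O" "x \<in> carrier ?O" "y \<in> carrier ?O"
      "a \<otimes>\<^bsub>?O\<^esub> x = b \<otimes>\<^bsub>?O\<^esub> y" "degree a \<le> degree b" for a b x y
  proof -
    obtain n m p q where pos: "positive True n a" "positive True m b" "positive True p x" "positive True q y"
      using * by auto
    note [simp] = pos[THEN positive_closed]
    have "inv\<^bsub>E\<^esub> (x \<otimes>\<^bsub>E\<^esub> a) = inv\<^bsub>E\<^esub> (y \<otimes>\<^bsub>E\<^esub> b)" using *(5) by simp
    then have "inv\<^bsub>E\<^esub> a \<otimes>\<^bsub>E\<^esub> inv\<^bsub>E\<^esub> x = inv\<^bsub>E\<^esub> b \<otimes>\<^bsub>E\<^esub> inv\<^bsub>E\<^esub> y"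
      by (simp add: E.inv_mult_group)
    then obtain r z where z: "positive False r z" "inv\<^bsub>E\<^esub> b = inv\<^bsub>E\<^esub> a \<otimes>\<^bsub>E\<^esub> z"
      using positive_rigid[of False n "inv\<^bsub>E\<^esub> a" m "inv\<^bsub>E\<^esub> b" p "inv\<^bsub>E\<^esub> x" q "inv\<^bsub>E\<^esub> y"]
        pos[THEN positive_inv] *(6) pos by (auto simp: degree_eq)
    have "b = inv\<^bsub>E\<^esub> (inv\<^bsub>E\<^esub> a \<otimes>\<^bsub>E\<^esub> z)" using z(2) by (metis E.inv_inv positive_closed pos(2))
    also have "\<dots> = inv\<^bsub>E\<^esub> z \<otimes>\<^bsub>E\<^esub> a"
      using positive_closed[OF z(1)] by (simp add: E.inv_mult_group)
    finally show ?thesis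
      using positive_inv[OF z(1)] by (intro bexI[of _ "inv\<^bsub>E\<^esub> z"]) auto
  qed
qed (use monoid_positive degree_mult ex_degree_nonzero positive_zero_Units in
      \<open>auto simp: degree_eq monoid_opposite Units_opposite\<close>)

text \<open>The defining relations of \<open>E\<close> are equations between positive elements, so a homomorphism on the
  positive monoid respects them and extends to \<open>E\<close>.\<close>

lemma positive_factors_uniquely:
  fixes T :: "('t, 'k) monoid_scheme"
  assumes T: "group T"
  shows "factors_uniquely positive_monoid E id T"
  unfolding factors_uniquely_def
proof
  fix f assume f: "f \<in> hom positive_monoid T"
  have fb: "(\<lambda>g. f (base g)) \<in> hom G T"
  proof (rule homI)
    fix x y assume "x \<in> carrier G" "y \<in> carrier G"
    then show "f (base (x \<otimes> y)) = f (base x) \<otimes>\<^bsub>T\<^esub> f (base y)"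
      using hom_mult[OF f, of "base x" "base y"] positive.base by (auto simp: base_mult)
  qed (use hom_in_carrier[OF f] positive.base in auto)
  have ft: "f (stable True i) \<in> carrier T" if "i \<in> I" for i
    using hom_in_carrier[OF f] positive_stable[OF that] by auto
  have "\<exists>\<phi>\<in>hom E T. (\<forall>g\<in>carrier G. \<phi> (base g) = f (base g)) \<and> (\<forall>i\<in>I. \<phi> (stable True i) = f (stable True i))"
  proof (rule extend_to_E[OF T fb])
    fix i h assume i: "i \<in> I" and h: "h \<in> H i"
    have pos: "positive True 0 (base h)" "positive True 0 (base (\<rho> i h))" "positive True 1 (stable True i)"
      using HNN_associated_closed[OF data i h] positive_stable[OF i] by (simp_all add: positive.base)
    then have mem: "base h \<in> carrier positive_monoid" "base (\<rho> i h) \<in> carrier positive_monoid"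
      "stable True i \<in> carrier positive_monoid" by auto
    show "f (base h) \<otimes>\<^bsub>T\<^esub> f (stable True i) = f (stable True i) \<otimes>\<^bsub>T\<^esub> f (base (\<rho> i h))"
      using hom_mult[OF f mem(1,3)] hom_mult[OF f mem(3,2)] stable_rel_True[OF i h] by simp
  qed (use ft in auto)
  then obtain \<phi> where \<phi>: "\<phi> \<in> hom E T" "\<And>g. g \<in> carrier G \<Longrightarrow> \<phi> (base g) = f (base g)"
    "\<And>i. i \<in> I \<Longrightarrow> \<phi> (stable True i) = f (stable True i)" by blast
  have eq: "\<phi> x = f x" if "positive True n x" for n x
    using that
  proof induction
    case (base g)
    then show ?case by (rule \<phi>(2))
  next
    case (stable g i n x)
    have tx: "positive True (Suc n) (stable True i \<otimes>\<^bsub>E\<^esub> x)"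
      using positive_mult[OF positive_stable[OF stable(2)] stable(3)] by simp
    then have mem: "base g \<in> carrier positive_monoid" "stable True i \<otimes>\<^bsub>E\<^esub> x \<in> carrier positive_monoid"
      "stable True i \<in> carrier positive_monoid" "x \<in> carrier positive_monoid"
      using positive.base[OF stable(1), of True] positive_stable[OF stable(2), of True] stable(3) by auto
    have "f (base g \<otimes>\<^bsub>E\<^esub> (stable True i \<otimes>\<^bsub>E\<^esub> x)) =
        f (base g) \<otimes>\<^bsub>T\<^esub> (f (stable True i) \<otimes>\<^bsub>T\<^esub> f x)"
      using hom_mult[OF f mem(1,2)] hom_mult[OF f mem(3,4)] by simp
    then show ?case
      using stable positive_closed[OF stable(3)]
      by (simp add: hom_mult[OF \<phi>(1)] base_closed stable_closed \<phi>)
  qed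
  let ?\<phi> = "restrict \<phi> (carrier E)"
  show "\<exists>!g. g \<in> hom E T \<inter> extensional (carrier E) \<and> (\<forall>x\<in>carrier positive_monoid. g (id x) = f x)"
  proof (rule ex1I[of _ ?\<phi>])
    have "?\<phi> \<in> hom E T" using \<phi>(1) by (auto simp: hom_def)
    then show "?\<phi> \<in> hom E T \<inter> extensional (carrier E) \<and> (\<forall>x\<in>carrier positive_monoid. ?\<phi> (id x) = f x)"
      using eq positive_closed by auto
    fix g assume g: "g \<in> hom E T \<inter> extensional (carrier E) \<and> (\<forall>x\<in>carrier positive_monoid. g (id x) = f x)"
    then have gh: "g \<in> hom E T" by blast
    have gf: "g x = f x" if "positive True n x" for n x using g that by auto
    show "g = ?\<phi>"
    proof (rule extensionalityI[of _ "carrier E"])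
      fix x assume x: "x \<in> carrier E"
      have "g x = \<phi> x"
        by (rule hom_E_eqI[OF T gh \<phi>(1) _ _ x])
          (use gf[OF positive.base] gf[OF positive_stable] \<phi> in auto)
      then show "g x = ?\<phi> x" using x by simp
    qed (use g in auto)
  qed
qed

lemma positive_group_of_fractions: "is_group_of_fractions positive_monoid E id"
  unfolding is_group_of_fractions_def
  by (intro conjI allI impI positive_factors_uniquely) (auto simp: hom_def positive_closed)

end

lemma HNN_extension_is_group_of_fractions:
  fixes E :: "('e, 'n) monoid_scheme"
  assumes "is_HNN_extension E G I H \<rho>"
  shows "\<exists>(M :: 'e monoid) u. rees_monoid M \<and> is_group_of_fractions M E u"
proof -
  have data: "HNN_data G I H \<rho>" and E: "group E" and iso: "E \<cong> HNN_extension G I H \<rho>"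
    using assms by (auto simp: is_HNN_extension_def)
  from iso have "HNN_extension G I H \<rho> \<cong> E"
    by (rule group.iso_sym[OF E])
  then obtain \<psi> where "\<psi> \<in> iso (HNN_extension G I H \<rho>) E"
    by (auto simp: is_iso_def)
  then interpret HNN_group G I H \<rho> E \<psi>
    using data E by (auto simp: HNN_group_def HNN_pair_def HNN_group_axioms_def HNN_pair_axioms_def HNN_data_def)
  show ?thesis
    using positive_left_rees positive_right_rees positive_group_of_fractions
    by (auto simp: rees_monoid_def)
qed

section \<open>Factorization in left Rees monoids\<close>

locale left_rees = monoid M for M :: "('a, 'm) monoid_scheme" (structure) +
  assumes rees: "left_rees_monoid M"
begin

lemma left_cancel:
  "a \<in> carrier M \<Longrightarrow> x \<in> carrier M \<Longrightarrow> y \<in> carrier M \<Longrightarrow> a \<otimes> x = a \<otimes> y \<Longrightarrow> x = y"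
  using rees unfolding left_rees_monoid_def left_cancellative_def by blast

lemma mem_ideal_iff: "x \<in> principal_right_ideal M a \<longleftrightarrow> (\<exists>y\<in>carrier M. x = a \<otimes> y)"
  by (auto simp: l_coset_def)

lemma generator_mem_ideal: "a \<in> carrier M \<Longrightarrow> a \<in> principal_right_ideal M a"
  unfolding mem_ideal_iff by (rule bexI[of _ \<one>]) simp_all

text \<open>Rigidity in terms of elements.\<close>

lemma comparable:
  assumes "a \<in> carrier M" "b \<in> carrier M" "x \<in> carrier M" "y \<in> carrier M" "a \<otimes> x = b \<otimes> y"
  shows "(\<exists>z\<in>carrier M. b = a \<otimes> z) \<or> (\<exists>z\<in>carrier M. a = b \<otimes> z)"
proof -
  have "a \<otimes> x \<in> principal_right_ideal M a \<inter> principal_right_ideal M b"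
    using assms unfolding Int_iff mem_ideal_iff by blast
  then have "principal_right_ideal M a \<subseteq> principal_right_ideal M b \<or>
      principal_right_ideal M b \<subseteq> principal_right_ideal M a"
    using rees assms(1,2) unfolding left_rees_monoid_def right_rigid_def by blast
  then show ?thesis
    using generator_mem_ideal[OF assms(1)] generator_mem_ideal[OF assms(2)]
    unfolding mem_ideal_iff[symmetric] by blast
qed

lemma right_inverse_Units:
  assumes "a \<in> carrier M" "b \<in> carrier M" "a \<otimes> b = \<one>"
  shows "a \<in> Units M"
proof -
  have "a \<otimes> (b \<otimes> a) = a \<otimes> \<one>"
    using assms by (simp add: m_assoc[symmetric])
  then have "b \<otimes> a = \<one>" using assms left_cancel[of a "b \<otimes> a" \<one>] by simp
  then show ?thesis using assms unfolding Units_def by blast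
qed

lemma Units_factor:
  assumes "a \<in> carrier M" "b \<in> carrier M" "a \<otimes> b \<in> Units M"
  shows "a \<in> Units M" "b \<in> Units M"
proof -
  have "a \<otimes> (b \<otimes> inv (a \<otimes> b)) = \<one>"
    using assms by (simp add: m_assoc[symmetric])
  then show a: "a \<in> Units M"
    using assms by (intro right_inverse_Units[of a "b \<otimes> inv (a \<otimes> b)"]) auto
  have eq: "inv a \<otimes> (a \<otimes> b) = b"
    using a assms(1,2) by (simp add: m_assoc[symmetric])
  have "inv a \<otimes> (a \<otimes> b) \<in> Units M"
    by (rule Units_m_closed[OF Units_inv_Units[OF a] assms(3)])
  then show "b \<in> Units M" unfolding eq .
qed

definition atom :: "'a \<Rightarrow> bool" where
  "atom a \<longleftrightarrow> a \<in> carrier M \<and> a \<notin> Units M \<and>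
     (\<forall>b\<in>carrier M. \<forall>c\<in>carrier M. a = b \<otimes> c \<longrightarrow> b \<in> Units M \<or> c \<in> Units M)"

lemma atom_closed: "atom a \<Longrightarrow> a \<in> carrier M"
  by (simp add: atom_def)

lemma atom_left_mult:
  assumes a: "atom a" and g: "g \<in> Units M"
  shows "atom (g \<otimes> a)"
  unfolding atom_def
proof (intro conjI ballI impI)
  have aM: "a \<in> carrier M" and gM: "g \<in> carrier M" using a g by (auto simp: atom_def)
  show "g \<otimes> a \<in> carrier M" using aM gM by simp
  show "g \<otimes> a \<notin> Units M" using Units_factor(2)[OF gM aM] a by (auto simp: atom_def)
  fix b c assume bc: "b \<in> carrier M" "c \<in> carrier M" "g \<otimes> a = b \<otimes> c"
  have gb: "inv g \<otimes> b \<in> carrier M" using g bc(1) by simp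
  have "(inv g \<otimes> b) \<otimes> c = inv g \<otimes> (b \<otimes> c)" using g bc(1,2) by (simp add: m_assoc)
  also have "\<dots> = a" unfolding bc(3)[symmetric] using g gM aM by (simp add: m_assoc[symmetric])
  finally have "inv g \<otimes> b \<in> Units M \<or> c \<in> Units M"
    using a gb bc(2) unfolding atom_def by blast
  then show "b \<in> Units M \<or> c \<in> Units M"
    using Units_factor(2)[of "inv g" b] g bc(1) by auto
qed

lemma atom_right_mult:
  assumes a: "atom a" and g: "g \<in> Units M"
  shows "atom (a \<otimes> g)"
  unfolding atom_def
proof (intro conjI ballI impI)
  have aM: "a \<in> carrier M" and gM: "g \<in> carrier M" using a g by (auto simp: atom_def)
  show "a \<otimes> g \<in> carrier M" using aM gM by simp
  show "a \<otimes> g \<notin> Units M" using Units_factor(1)[OF aM gM] a by (auto simp: atom_def)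
  fix b c assume bc: "b \<in> carrier M" "c \<in> carrier M" "a \<otimes> g = b \<otimes> c"
  have cg: "c \<otimes> inv g \<in> carrier M" using g bc(2) by simp
  have "b \<otimes> (c \<otimes> inv g) = (b \<otimes> c) \<otimes> inv g" using g bc(1,2) by (simp add: m_assoc)
  also have "\<dots> = a" unfolding bc(3)[symmetric] using g gM aM by (simp add: m_assoc)
  finally have "b \<in> Units M \<or> c \<otimes> inv g \<in> Units M"
    using a cg bc(1) unfolding atom_def by blast
  then show "b \<in> Units M \<or> c \<in> Units M"
    using Units_factor(1)[of c "inv g"] g bc(2) by auto
qed

text \<open>An atom has no proper divisors, so comparable atoms generate the same right ideal.\<close>

lemma atoms_comparable:
  assumes a: "atom a" and b: "atom b" and "x \<in> carrier M" "y \<in> carrier M" "a \<otimes> x = b \<otimes> y"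
  shows "\<exists>z\<in>Units M. b = a \<otimes> z"
proof -
  have aM: "a \<in> carrier M" and bM: "b \<in> carrier M" using a b by (auto simp: atom_def)
  from comparable[OF aM bM assms(3-5)] show ?thesis
  proof (elim disjE bexE)
    fix z assume "z \<in> carrier M" "b = a \<otimes> z"
    then show ?thesis using a b by (auto simp: atom_def)
  next
    fix z assume z: "z \<in> carrier M" "a = b \<otimes> z"
    then have zU: "z \<in> Units M" using a b by (auto simp: atom_def)
    then have "b = a \<otimes> inv z" unfolding z(2) using bM by (simp add: m_assoc Units_closed)
    then show ?thesis using zU by (intro bexI[of _ "inv z"]) auto
  qed
qed

text \<open>The finiteness condition makes this a natural number that measures how deep an element lies; it
  is the induction measure for factorizations.\<close>

definition height :: "'a \<Rightarrow> nat" where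
  "height m = card {J \<in> principal_right_ideal M ` carrier M. principal_right_ideal M m \<subset> J}"

lemma height_less:
  assumes b: "b \<in> carrier M" and c: "c \<in> carrier M" "c \<notin> Units M"
  shows "height b < height (b \<otimes> c)"
  unfolding height_def
proof (rule psubset_card_mono)
  let ?above = "\<lambda>m. {J \<in> principal_right_ideal M ` carrier M. principal_right_ideal M m \<subset> J}"
  have bc: "b \<otimes> c \<in> carrier M" using b c by simp
  then show "finite (?above (b \<otimes> c))"
    using rees unfolding left_rees_monoid_def by (elim conjE) (rule bspec)
  have sub: "principal_right_ideal M (b \<otimes> c) \<subseteq> principal_right_ideal M b"
  proof
    fix x assume "x \<in> principal_right_ideal M (b \<otimes> c)"
    then obtain y where "y \<in> carrier M" "x = b \<otimes> c \<otimes> y" unfolding mem_ideal_iff by blast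
    then have "c \<otimes> y \<in> carrier M" "x = b \<otimes> (c \<otimes> y)" using b c by (simp_all add: m_assoc)
    then show "x \<in> principal_right_ideal M b" unfolding mem_ideal_iff by blast
  qed
  have "b \<notin> principal_right_ideal M (b \<otimes> c)"
  proof
    assume "b \<in> principal_right_ideal M (b \<otimes> c)"
    then obtain y where y: "y \<in> carrier M" "b = b \<otimes> c \<otimes> y" unfolding mem_ideal_iff by blast
    then have "b \<otimes> (c \<otimes> y) = b \<otimes> \<one>" using b c by (simp add: m_assoc)
    then have "c \<otimes> y = \<one>" using left_cancel[of b "c \<otimes> y" \<one>] b c y by simp
    then show False using right_inverse_Units[OF c(1) y(1)] c(2) by simp
  qed
  then have strict: "principal_right_ideal M (b \<otimes> c) \<subset> principal_right_ideal M b"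
    using sub generator_mem_ideal[OF b] by blast
  then have "principal_right_ideal M b \<in> ?above (b \<otimes> c)" using b by simp
  moreover have "principal_right_ideal M b \<notin> ?above b" by simp
  moreover have "?above b \<subseteq> ?above (b \<otimes> c)"
    by (intro Collect_mono) (use psubset_trans[OF strict] in simp)
  ultimately show "?above b \<subset> ?above (b \<otimes> c)" by blast
qed

text \<open>Among the factorizations \<open>m = b c\<close> with a non-unit \<open>c\<close>, one whose left factor \<open>b\<close> has the greatest
  height has an atom as right factor, since splitting \<open>c\<close> would give a
  left factor of greater height. Splitting off the last
  factor is convenient because \<open>b\<close> then has smaller height than \<open>m\<close>.\<close>

lemma last_atom:
  assumes m: "m \<in> carrier M" "m \<notin> Units M"
  obtains b c where "b \<in> carrier M" "atom c" "m = b \<otimes> c"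
proof -
  define P where "P = (\<lambda>b. b \<in> carrier M \<and> (\<exists>c\<in>carrier M. c \<notin> Units M \<and> m = b \<otimes> c))"
  have one: "P \<one>" unfolding P_def using m by (intro conjI bexI[of _ m]) simp_all
  have bound: "height b < height m" if "P b" for b
    using that height_less unfolding P_def by auto
  have "\<exists>b. P b \<and> (\<forall>d. P d \<longrightarrow> height d \<le> height b)"
    by (rule ex_has_greatest_nat[of P \<one> height "height m"]) (use one bound in auto)
  then obtain b where b: "P b" and max: "\<And>d. P d \<Longrightarrow> height d \<le> height b" by auto
  from b obtain c where c: "b \<in> carrier M" "c \<in> carrier M" "c \<notin> Units M" "m = b \<otimes> c"
    by (auto simp: P_def)
  have "atom c"
    unfolding atom_def
  proof (intro conjI ballI impI c)
    fix d e assume de: "d \<in> carrier M" "e \<in> carrier M" "c = d \<otimes> e"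
    show "d \<in> Units M \<or> e \<in> Units M"
    proof (rule ccontr)
      assume "\<not> (d \<in> Units M \<or> e \<in> Units M)"
      then have d: "d \<notin> Units M" and e: "e \<notin> Units M" by auto
      have "m = (b \<otimes> d) \<otimes> e" using c de by (simp add: m_assoc)
      then have "P (b \<otimes> d)" unfolding P_def using c(1) de(1,2) e by blast
      then show False using max[of "b \<otimes> d"] height_less[OF c(1) de(1) d] by simp
    qed
  qed
  then show thesis using that c by blast
qed

end

section \<open>Homomorphisms out of a left Rees monoid\<close>

text \<open>The data for a homomorphism from \<open>M\<close> to a group: values on the units and on the atoms that are
  compatible with multiplying an atom by units.\<close>

locale letter_map = left_rees M + T: group T
  for M :: "('a, 'm) monoid_scheme" (structure) and T :: "('t, 'k) monoid_scheme" +
  fixes f F :: "'a \<Rightarrow> 't"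
  assumes f_hom: "f \<in> hom (units_of M) T"
    and F_closed: "atom a \<Longrightarrow> F a \<in> carrier T"
    and F_left: "g \<in> Units M \<Longrightarrow> atom a \<Longrightarrow> F (g \<otimes> a) = f g \<otimes>\<^bsub>T\<^esub> F a"
    and F_right: "g \<in> Units M \<Longrightarrow> atom a \<Longrightarrow> F (a \<otimes> g) = F a \<otimes>\<^bsub>T\<^esub> f g"
begin

lemma f_closed: "g \<in> Units M \<Longrightarrow> f g \<in> carrier T"
  using hom_in_carrier[OF f_hom] by (simp add: units_of_carrier)

lemma f_mult: "g \<in> Units M \<Longrightarrow> h \<in> Units M \<Longrightarrow> f (g \<otimes> h) = f g \<otimes>\<^bsub>T\<^esub> f h"
  using hom_mult[OF f_hom] by (simp add: units_of_carrier units_of_mult)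

lemma f_one: "f \<one> = \<one>\<^bsub>T\<^esub>"
  using hom_one[OF f_hom units_group T.is_group] by (simp add: units_of_one)

text \<open>The homomorphism to be constructed, as a relation: \<open>graph m p\<close> holds if some factorization of \<open>m\<close>
  into atoms and a final unit has the value \<open>p\<close>. It is total because factorizations exist, and
  single-valued because they are unique up to units.\<close>

inductive graph :: "'a \<Rightarrow> 't \<Rightarrow> bool" where
  unit: "g \<in> Units M \<Longrightarrow> graph g (f g)"
| atom: "atom a \<Longrightarrow> graph m p \<Longrightarrow> graph (a \<otimes> m) (F a \<otimes>\<^bsub>T\<^esub> p)"

lemma graph_closed: "graph m p \<Longrightarrow> m \<in> carrier M \<and> p \<in> carrier T"
  by (induction rule: graph.induct) (auto simp: f_closed F_closed atom_closed)

lemma graph_atom: "atom a \<Longrightarrow> graph a (F a)"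
  using graph.atom[OF _ graph.unit[OF Units_one_closed], of a]
  by (simp add: f_one atom_closed F_closed)

lemma graph_unit_mult:
  assumes "graph m p" and g: "g \<in> Units M"
  shows "graph (g \<otimes> m) (f g \<otimes>\<^bsub>T\<^esub> p)"
  using assms(1)
proof cases
  case unit
  then show ?thesis using graph.unit[of "g \<otimes> m"] g by (simp add: f_mult)
next
  case (atom a n q)
  then show ?thesis
    using graph.atom[OF atom_left_mult[OF atom(3) g] atom(4)] graph_closed[OF atom(4)] g
    by (simp add: F_left F_closed f_closed atom_closed m_assoc T.m_assoc Units_closed)
qed

lemma graph_mult: "graph m p \<Longrightarrow> graph n q \<Longrightarrow> graph (m \<otimes> n) (p \<otimes>\<^bsub>T\<^esub> q)"
proof (induction rule: graph.induct)
  case (unit g)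
  then show ?case by (simp add: graph_unit_mult)
next
  case (atom a m p)
  have "graph (a \<otimes> (m \<otimes> n)) (F a \<otimes>\<^bsub>T\<^esub> (p \<otimes>\<^bsub>T\<^esub> q))"
    using atom by (intro graph.atom)
  then show ?case
    using atom(1) graph_closed[OF atom(2)] graph_closed[OF atom(4)]
    by (simp add: m_assoc T.m_assoc atom_closed F_closed)
qed

lemma atom_mult_not_unit: "atom a \<Longrightarrow> m \<in> carrier M \<Longrightarrow> a \<otimes> m \<notin> Units M"
  using Units_factor(1)[of a m] by (auto simp: atom_def)

text \<open>If \<open>a m = b n\<close> with atoms \<open>a\<close> and \<open>b\<close>, then \<open>b = a z\<close> and \<open>m = z n\<close> for a unit \<open>z\<close>, and the
  compatibility of the values absorbs \<open>z\<close>.\<close>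

lemma graph_unique: "graph m p \<Longrightarrow> graph m q \<Longrightarrow> p = q"
proof (induction arbitrary: q rule: graph.induct)
  case (unit g)
  from unit(2) show ?case
  proof cases
    case (atom a n r)
    then show ?thesis using atom_mult_not_unit graph_closed unit(1) by blast
  qed simp
next
  case (atom a m p)
  have m: "m \<in> carrier M" and p: "p \<in> carrier T" using graph_closed[OF atom(2)] by auto
  from atom(4) show ?case
  proof cases
    case unit
    then show ?thesis using atom_mult_not_unit[OF atom(1) m] by simp
  next
    case b: (atom b n r)
    have n: "n \<in> carrier M" and r: "r \<in> carrier T" using graph_closed[OF b(4)] by auto
    have a: "a \<in> carrier M" using atom(1) by (rule atom_closed)
    obtain z where z: "z \<in> Units M" "b = a \<otimes> z"
      using atoms_comparable[OF atom(1) b(3) m n b(1)] by blast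
    have "a \<otimes> m = a \<otimes> (z \<otimes> n)" using b(1) z a n by (simp add: m_assoc Units_closed)
    then have "m = z \<otimes> n" using left_cancel[OF a m] z(1) n by (simp add: Units_closed)
    then have "graph m (f z \<otimes>\<^bsub>T\<^esub> r)" using graph_unit_mult[OF b(4) z(1)] by simp
    then have "p = f z \<otimes>\<^bsub>T\<^esub> r" by (rule atom.IH)
    then show ?thesis
      using z atom(1) r b(2) by (simp add: F_right f_closed F_closed T.m_assoc)
  qed
qed

lemma graph_total: "m \<in> carrier M \<Longrightarrow> \<exists>p. graph m p"
proof (induction "height m" arbitrary: m rule: less_induct)
  case less
  show ?case
  proof (cases "m \<in> Units M")
    case True
    then show ?thesis using graph.unit by blast
  next
    case False
    with less.prems obtain b c where bc: "b \<in> carrier M" "atom c" "m = b \<otimes> c"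
      by (rule last_atom)
    then have "height b < height m"
      using height_less[of b c] by (auto simp: atom_def)
    then obtain p where "graph b p" using less.hyps bc(1) by blast
    then show ?thesis using graph_mult[OF _ graph_atom[OF bc(2)]] bc(3) by blast
  qed
qed

lemma ex_extension:
  "\<exists>\<phi>\<in>hom M T. (\<forall>g\<in>Units M. \<phi> g = f g) \<and> (\<forall>a. atom a \<longrightarrow> \<phi> a = F a)"
proof -
  define \<phi> where "\<phi> = (\<lambda>m. THE p. graph m p)"
  have \<phi>: "\<phi> m = p" if "graph m p" for m p
    unfolding \<phi>_def using that graph_unique by blast
  have graph_\<phi>: "graph m (\<phi> m)" if "m \<in> carrier M" for m
    using graph_total[OF that] \<phi> by auto
  have "\<phi> \<in> hom M T"
    by (rule homI) (use graph_\<phi> graph_closed \<phi>[OF graph_mult] in blast)+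
  moreover have "\<phi> g = f g" if "g \<in> Units M" for g using \<phi>[OF graph.unit[OF that]] .
  moreover have "\<phi> a = F a" if "atom a" for a using \<phi>[OF graph_atom[OF that]] .
  ultimately show ?thesis by blast
qed

end

section \<open>The HNN-extension of a Rees monoid\<close>

context left_rees
begin

text \<open>One stable letter is taken for each double coset \<open>G a G\<close> of an atom \<open>a\<close>, where \<open>G\<close> is the group
  of units. As index serves the chosen representative itself. The associated subgroup at \<open>i\<close> is the
  stabilizer of \<open>i G\<close> in \<open>G\<close>.\<close>

definition double_coset :: "'a \<Rightarrow> 'a set" where
  "double_coset a = {g \<otimes> a \<otimes> h | g h. g \<in> Units M \<and> h \<in> Units M}"

definition atom_rep :: "'a \<Rightarrow> 'a" where
  "atom_rep a = (SOME b. b \<in> double_coset a)"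

definition atom_reps :: "'a set" where
  "atom_reps = {atom_rep a | a. atom a}"

definition edge_group :: "'a \<Rightarrow> 'a set" where
  "edge_group i = {g \<in> Units M. \<exists>h\<in>Units M. g \<otimes> i = i \<otimes> h}"

definition edge_hom :: "'a \<Rightarrow> 'a \<Rightarrow> 'a" where
  "edge_hom i g = (THE h. h \<in> Units M \<and> g \<otimes> i = i \<otimes> h)"

lemma double_coset_mult:
  assumes a: "a \<in> carrier M" and g: "g \<in> Units M" and h: "h \<in> Units M"
  shows "double_coset (g \<otimes> a \<otimes> h) = double_coset a"
proof -
  have sub: "double_coset (g \<otimes> a \<otimes> h) \<subseteq> double_coset a"
    if "a \<in> carrier M" "g \<in> Units M" "h \<in> Units M" for a g h
  proof
    fix x assume "x \<in> double_coset (g \<otimes> a \<otimes> h)"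
    then obtain g' h' where gh: "g' \<in> Units M" "h' \<in> Units M" "x = g' \<otimes> (g \<otimes> a \<otimes> h) \<otimes> h'"
      unfolding double_coset_def by blast
    then have "x = (g' \<otimes> g) \<otimes> a \<otimes> (h \<otimes> h')"
      using that by (simp add: m_assoc Units_closed)
    moreover have "g' \<otimes> g \<in> Units M" "h \<otimes> h' \<in> Units M" using gh that by auto
    ultimately show "x \<in> double_coset a" unfolding double_coset_def by blast
  qed
  have "inv g \<otimes> (g \<otimes> a \<otimes> h) \<otimes> inv h = inv g \<otimes> g \<otimes> a \<otimes> (h \<otimes> inv h)"
    using a g h by (simp add: m_assoc Units_closed del: Units_l_inv Units_r_inv)
  also have "\<dots> = a" using a g h by simp
  finally have "double_coset a \<subseteq> double_coset (g \<otimes> a \<otimes> h)"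
    using sub[of "g \<otimes> a \<otimes> h" "inv g" "inv h"] a g h by (simp add: Units_closed)
  then show ?thesis using sub[OF a g h] by blast
qed

lemma atom_rep_mult:
  "a \<in> carrier M \<Longrightarrow> g \<in> Units M \<Longrightarrow> h \<in> Units M \<Longrightarrow> atom_rep (g \<otimes> a \<otimes> h) = atom_rep a"
  by (simp add: atom_rep_def double_coset_mult)

lemma self_mem_double_coset: "a \<in> carrier M \<Longrightarrow> a \<in> double_coset a"
  unfolding double_coset_def by (intro CollectI exI[of _ \<one>]) simp

lemma atom_rep_factor:
  assumes a: "a \<in> carrier M"
  shows "\<exists>g\<in>Units M. \<exists>h\<in>Units M. a = g \<otimes> atom_rep a \<otimes> h"
proof -
  have "atom_rep a \<in> double_coset a"
    unfolding atom_rep_def using self_mem_double_coset[OF a] by (rule someI)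
  then obtain g h where gh: "g \<in> Units M" "h \<in> Units M" "atom_rep a = g \<otimes> a \<otimes> h"
    unfolding double_coset_def by blast
  have "inv g \<otimes> (g \<otimes> a \<otimes> h) \<otimes> inv h = inv g \<otimes> g \<otimes> a \<otimes> (h \<otimes> inv h)"
    using a gh(1,2) by (simp add: m_assoc Units_closed del: Units_l_inv Units_r_inv)
  also have "\<dots> = a" using a gh(1,2) by simp
  finally have "a = inv g \<otimes> atom_rep a \<otimes> inv h" unfolding gh(3) ..
  then show ?thesis using gh(1,2) Units_inv_Units by blast
qed

lemma atom_reps_atom: "i \<in> atom_reps \<Longrightarrow> atom i"
proof -
  assume "i \<in> atom_reps"
  then obtain a where a: "atom a" "i = atom_rep a" by (auto simp: atom_reps_def)
  have "atom_rep a \<in> double_coset a"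
    unfolding atom_rep_def using self_mem_double_coset[OF atom_closed[OF a(1)]] by (rule someI)
  then show "atom i"
    unfolding a(2) double_coset_def using a(1) atom_left_mult atom_right_mult by auto
qed

lemma atom_rep_in_reps: "atom a \<Longrightarrow> atom_rep a \<in> atom_reps"
  by (auto simp: atom_reps_def)

lemma atom_rep_of_rep: "i \<in> atom_reps \<Longrightarrow> atom_rep i = i"
proof -
  assume "i \<in> atom_reps"
  then obtain a where a: "atom a" "i = atom_rep a" by (auto simp: atom_reps_def)
  obtain g h where gh: "g \<in> Units M" "h \<in> Units M" "a = g \<otimes> atom_rep a \<otimes> h"
    using atom_rep_factor[OF atom_closed[OF a(1)]] by blast
  have "i \<in> carrier M" using \<open>i \<in> atom_reps\<close> atom_reps_atom atom_closed by blast
  then show "atom_rep i = i"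
    using atom_rep_mult[of i g h] gh a(2) by simp
qed

lemma edge_hom_eqI:
  "i \<in> carrier M \<Longrightarrow> h \<in> Units M \<Longrightarrow> g \<otimes> i = i \<otimes> h \<Longrightarrow> edge_hom i g = h"
  unfolding edge_hom_def using left_cancel[of i] by (intro the_equality) (auto simp: Units_closed)

lemma edge_hom:
  assumes "i \<in> carrier M" "g \<in> edge_group i"
  shows "g \<in> Units M" "edge_hom i g \<in> Units M" "g \<otimes> i = i \<otimes> edge_hom i g"
  using assms edge_hom_eqI by (auto simp: edge_group_def)

lemma edge_hom_mult:
  assumes i: "i \<in> carrier M" and g: "g \<in> edge_group i" and h: "h \<in> edge_group i"
  shows "(g \<otimes> h) \<otimes> i = i \<otimes> (edge_hom i g \<otimes> edge_hom i h)"
proof -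
  note G = edge_hom[OF i g] edge_hom[OF i h]
  have "(g \<otimes> h) \<otimes> i = g \<otimes> (i \<otimes> edge_hom i h)"
    using i G(1,4) by (simp add: m_assoc Units_closed G(6)[symmetric])
  also have "\<dots> = (g \<otimes> i) \<otimes> edge_hom i h"
    using i G(1,5) by (simp add: m_assoc Units_closed)
  also have "\<dots> = i \<otimes> (edge_hom i g \<otimes> edge_hom i h)"
    unfolding G(3) using i G(2,5) by (simp add: m_assoc Units_closed)
  finally show ?thesis .
qed

lemma edge_inverse:
  assumes i: "i \<in> carrier M" and g: "g \<in> edge_group i"
  shows "inv g \<otimes> i = i \<otimes> inv (edge_hom i g)"
proof -
  note G = edge_hom[OF i g]
  have "inv g \<otimes> i = inv g \<otimes> (i \<otimes> edge_hom i g) \<otimes> inv (edge_hom i g)"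
    using i G(1,2) by (simp add: m_assoc Units_closed)
  also have "\<dots> = i \<otimes> inv (edge_hom i g)"
    unfolding G(3)[symmetric] using i G(1,2) by (simp add: m_assoc[symmetric] Units_closed)
  finally show ?thesis .
qed

lemma atom_exists: "\<exists>a. atom a"
proof -
  have "\<exists>m\<in>carrier M. m \<notin> Units M"
    using rees unfolding left_rees_monoid_def group_def group_axioms_def by blast
  then show ?thesis using last_atom by blast
qed

lemma subgroup_edge_group:
  assumes i: "i \<in> carrier M"
  shows "subgroup (edge_group i) (units_of M)"
proof (rule group.subgroupI[OF units_group])
  show "edge_group i \<subseteq> carrier (units_of M)" by (auto simp: edge_group_def units_of_carrier)
  have "\<one> \<in> edge_group i" using i by (auto simp: edge_group_def intro!: bexI[of _ \<one>])
  then show "edge_group i \<noteq> {}" by blast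
  fix g assume g: "g \<in> edge_group i"
  note G = edge_hom[OF i g]
  have "inv g \<in> edge_group i"
    unfolding edge_group_def using G edge_inverse[OF i g] by blast
  then show "inv\<^bsub>units_of M\<^esub> g \<in> edge_group i" using G(1) by (simp add: units_of_inv)
  fix h assume h: "h \<in> edge_group i"
  have "g \<otimes> h \<in> edge_group i"
    unfolding edge_group_def using G edge_hom[OF i h] edge_hom_mult[OF i g h] Units_m_closed by blast
  then show "g \<otimes>\<^bsub>units_of M\<^esub> h \<in> edge_group i" by (simp add: units_of_mult)
qed

lemma HNN_data_of_monoid:
  assumes canc: "right_cancellative M"
  shows "HNN_data (units_of M) atom_reps edge_group edge_hom"
  unfolding HNN_data_def
proof (intro conjI ballI)
  show "atom_reps \<noteq> {}" using atom_exists by (auto simp: atom_reps_def)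
  fix i assume "i \<in> atom_reps"
  then have i: "i \<in> carrier M" using atom_reps_atom atom_closed by blast
  show "subgroup (edge_group i) (units_of M)" using i by (rule subgroup_edge_group)
  have "edge_hom i \<in> hom (units_of M\<lparr>carrier := edge_group i\<rparr>) (units_of M)"
  proof (rule homI)
    fix g h assume "g \<in> carrier (units_of M\<lparr>carrier := edge_group i\<rparr>)"
      "h \<in> carrier (units_of M\<lparr>carrier := edge_group i\<rparr>)"
    then have gh: "g \<in> edge_group i" "h \<in> edge_group i" by simp_all
    have "edge_hom i (g \<otimes> h) = edge_hom i g \<otimes> edge_hom i h"
      using edge_hom[OF i gh(1)] edge_hom[OF i gh(2)] edge_hom_mult[OF i gh]
      by (intro edge_hom_eqI[OF i]) auto
    then show "edge_hom i (g \<otimes>\<^bsub>units_of M\<lparr>carrier := edge_group i\<rparr>\<^esub> h) =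
        edge_hom i g \<otimes>\<^bsub>units_of M\<^esub> edge_hom i h" by (simp add: units_of_mult)
  qed (use edge_hom[OF i] in \<open>simp add: units_of_carrier\<close>)
  moreover have "inj_on (edge_hom i) (edge_group i)"
  proof (rule inj_onI)
    fix g h assume g: "g \<in> edge_group i" and h: "h \<in> edge_group i" and eq: "edge_hom i g = edge_hom i h"
    then have "g \<otimes> i = h \<otimes> i" using edge_hom(3)[OF i] by simp
    then show "g = h"
      using canc i edge_hom(1)[OF i g] edge_hom(1)[OF i h] Units_closed
      unfolding right_cancellative_def by blast
  qed
  ultimately show "edge_hom i \<in> mon (units_of M\<lparr>carrier := edge_group i\<rparr>) (units_of M)"
    by (simp add: mon_def)
qed (rule units_group)

text \<open>The ambiguity in writing an atom as \<open>g i h\<close> is exactly an HNN-relation.\<close>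

lemma unit_conjugation:
  assumes i: "i \<in> carrier M" and g: "g \<in> Units M" "g' \<in> Units M" and h: "h \<in> Units M" "h' \<in> Units M"
    and eq: "g \<otimes> i \<otimes> h = g' \<otimes> i \<otimes> h'"
  shows "inv g' \<otimes> g \<in> edge_group i" "edge_hom i (inv g' \<otimes> g) = h' \<otimes> inv h"
proof -
  have "(inv g' \<otimes> g) \<otimes> i = inv g' \<otimes> (g \<otimes> i \<otimes> h) \<otimes> inv h"
    using i g h by (simp add: m_assoc Units_closed)
  also have "\<dots> = i \<otimes> (h' \<otimes> inv h)"
    unfolding eq using i g h by (simp add: m_assoc[symmetric] Units_closed)
  finally have *: "(inv g' \<otimes> g) \<otimes> i = i \<otimes> (h' \<otimes> inv h)" .
  have U: "inv g' \<otimes> g \<in> Units M" "h' \<otimes> inv h \<in> Units M" using g h by auto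
  show "inv g' \<otimes> g \<in> edge_group i" unfolding edge_group_def using U * by blast
  show "edge_hom i (inv g' \<otimes> g) = h' \<otimes> inv h" using edge_hom_eqI[OF i U(2) *] .
qed

end

locale cancellative_left_rees = left_rees M for M :: "('a, 'm) monoid_scheme" (structure) +
  assumes right_canc: "right_cancellative M"
begin

abbreviation ext :: "('a + 'a) gword set monoid" where
  "ext \<equiv> HNN_extension (units_of M) atom_reps edge_group edge_hom"

abbreviation unit_image :: "'a \<Rightarrow> ('a + 'a) gword set" where
  "unit_image \<equiv> HNN_base (units_of M) atom_reps edge_group edge_hom"

abbreviation letter :: "'a \<Rightarrow> ('a + 'a) gword set" where
  "letter \<equiv> HNN_stable (units_of M) atom_reps edge_group edge_hom"

lemma data: "HNN_data (units_of M) atom_reps edge_group edge_hom"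
  using right_canc by (rule HNN_data_of_monoid)

sublocale ext: group ext
  unfolding HNN_extension_def by (rule group_presented_group)

lemma unit_image_closed: "g \<in> Units M \<Longrightarrow> unit_image g \<in> carrier ext"
  using hom_in_carrier[OF HNN_base_hom[OF data]] by (simp add: units_of_carrier)

lemma unit_image_mult: "g \<in> Units M \<Longrightarrow> h \<in> Units M \<Longrightarrow> unit_image (g \<otimes> h) = unit_image g \<otimes>\<^bsub>ext\<^esub> unit_image h"
  using hom_mult[OF HNN_base_hom[OF data]] by (simp add: units_of_carrier units_of_mult)

lemma unit_image_one: "unit_image \<one> = \<one>\<^bsub>ext\<^esub>"
  using hom_one[OF HNN_base_hom[OF data] units_group ext.is_group] by (simp add: units_of_one)

lemma letter_closed: "i \<in> atom_reps \<Longrightarrow> letter i \<in> carrier ext"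
  by (rule HNN_stable_closed)

text \<open>The product in the HNN-extension does not depend on the choice of \<open>g\<close> and \<open>h\<close>, by
  \<open>letter_well_defined\<close>; this is where the relations of the extension are used.\<close>

definition atom_image :: "'a \<Rightarrow> ('a + 'a) gword set" where
  "atom_image a = (THE p. \<exists>g\<in>Units M. \<exists>h\<in>Units M. a = g \<otimes> atom_rep a \<otimes> h \<and>
     p = unit_image g \<otimes>\<^bsub>ext\<^esub> letter (atom_rep a) \<otimes>\<^bsub>ext\<^esub> unit_image h)"

lemma letter_well_defined:
  assumes i: "i \<in> atom_reps" and g: "g \<in> Units M" "g' \<in> Units M" and h: "h \<in> Units M" "h' \<in> Units M"
    and eq: "g \<otimes> i \<otimes> h = g' \<otimes> i \<otimes> h'"
  shows "unit_image g \<otimes>\<^bsub>ext\<^esub> letter i \<otimes>\<^bsub>ext\<^esub> unit_image h = unit_image g' \<otimes>\<^bsub>ext\<^esub> letter i \<otimes>\<^bsub>ext\<^esub> unit_image h'"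
proof -
  have iM: "i \<in> carrier M" using i atom_reps_atom atom_closed by blast
  define k where "k = inv g' \<otimes> g"
  define l where "l = h' \<otimes> inv h"
  have kl: "k \<in> Units M" "l \<in> Units M" using g h by (auto simp: k_def l_def)
  have k: "k \<in> edge_group i" "edge_hom i k = l"
    using unit_conjugation[OF iM g h eq] by (simp_all add: k_def l_def)
  have rel: "unit_image k \<otimes>\<^bsub>ext\<^esub> letter i = letter i \<otimes>\<^bsub>ext\<^esub> unit_image l"
    using HNN_stable_relation[OF data i k(1)] k(2) by simp
  have gk: "unit_image g = unit_image g' \<otimes>\<^bsub>ext\<^esub> unit_image k"
    using g kl by (simp flip: unit_image_mult) (simp add: k_def m_assoc[symmetric] Units_closed)
  have hl: "unit_image h' = unit_image l \<otimes>\<^bsub>ext\<^esub> unit_image h"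
    using h kl by (simp flip: unit_image_mult) (simp add: l_def m_assoc Units_closed)
  note [simp] = unit_image_closed letter_closed[OF i] kl g h
  have "unit_image g \<otimes>\<^bsub>ext\<^esub> letter i \<otimes>\<^bsub>ext\<^esub> unit_image h = unit_image g' \<otimes>\<^bsub>ext\<^esub> (unit_image k \<otimes>\<^bsub>ext\<^esub> letter i) \<otimes>\<^bsub>ext\<^esub> unit_image h"
    unfolding gk by (simp add: ext.m_assoc)
  also have "\<dots> = unit_image g' \<otimes>\<^bsub>ext\<^esub> letter i \<otimes>\<^bsub>ext\<^esub> unit_image h'"
    unfolding rel hl by (simp add: ext.m_assoc)
  finally show ?thesis .
qed

lemma atom_image_eq:
  assumes a: "atom a" and g: "g \<in> Units M" and h: "h \<in> Units M" and eq: "a = g \<otimes> atom_rep a \<otimes> h"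
  shows "atom_image a = unit_image g \<otimes>\<^bsub>ext\<^esub> letter (atom_rep a) \<otimes>\<^bsub>ext\<^esub> unit_image h"
  unfolding atom_image_def
proof (rule the_equality)
  show "\<exists>g'\<in>Units M. \<exists>h'\<in>Units M. a = g' \<otimes> atom_rep a \<otimes> h' \<and>
      unit_image g \<otimes>\<^bsub>ext\<^esub> letter (atom_rep a) \<otimes>\<^bsub>ext\<^esub> unit_image h =
      unit_image g' \<otimes>\<^bsub>ext\<^esub> letter (atom_rep a) \<otimes>\<^bsub>ext\<^esub> unit_image h'"
    using g h eq by blast
  fix p
  assume "\<exists>g\<in>Units M. \<exists>h\<in>Units M. a = g \<otimes> atom_rep a \<otimes> h \<and>
      p = unit_image g \<otimes>\<^bsub>ext\<^esub> letter (atom_rep a) \<otimes>\<^bsub>ext\<^esub> unit_image h"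
  then obtain g' h' where gh: "g' \<in> Units M" "h' \<in> Units M" "a = g' \<otimes> atom_rep a \<otimes> h'"
    "p = unit_image g' \<otimes>\<^bsub>ext\<^esub> letter (atom_rep a) \<otimes>\<^bsub>ext\<^esub> unit_image h'" by blast
  have "g' \<otimes> atom_rep a \<otimes> h' = a" by (rule gh(3)[symmetric])
  also have "a = g \<otimes> atom_rep a \<otimes> h" by (rule eq)
  finally show "p = unit_image g \<otimes>\<^bsub>ext\<^esub> letter (atom_rep a) \<otimes>\<^bsub>ext\<^esub> unit_image h"
    unfolding gh(4) by (intro letter_well_defined atom_rep_in_reps a gh g h)
qed

lemma atom_image_mult:
  assumes a: "atom a" and g: "g \<in> Units M" and h: "h \<in> Units M"
  shows "atom_image (g \<otimes> a \<otimes> h) = unit_image g \<otimes>\<^bsub>ext\<^esub> atom_image a \<otimes>\<^bsub>ext\<^esub> unit_image h"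
    and "atom_image a \<in> carrier ext"
proof -
  have aM: "a \<in> carrier M" using a by (rule atom_closed)
  obtain k l where kl: "k \<in> Units M" "l \<in> Units M" "a = k \<otimes> atom_rep a \<otimes> l"
    using atom_rep_factor[OF aM] by blast
  have rep: "atom_rep (g \<otimes> a \<otimes> h) = atom_rep a" using atom_rep_mult[OF aM g h] .
  have i: "atom_rep a \<in> atom_reps" using a by (rule atom_rep_in_reps)
  then have iM: "atom_rep a \<in> carrier M" using atom_reps_atom atom_closed by blast
  note img = atom_image_eq[OF a kl]
  show "atom_image a \<in> carrier ext"
    unfolding img using kl(1,2) i by (simp add: unit_image_closed letter_closed)
  have "g \<otimes> a \<otimes> h = g \<otimes> (k \<otimes> atom_rep a \<otimes> l) \<otimes> h" using kl(3) by (rule arg_cong)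
  also have "\<dots> = (g \<otimes> k) \<otimes> atom_rep (g \<otimes> a \<otimes> h) \<otimes> (l \<otimes> h)"
    unfolding rep using iM g h kl(1,2) by (simp add: m_assoc Units_closed)
  finally have "atom_image (g \<otimes> a \<otimes> h) =
      unit_image (g \<otimes> k) \<otimes>\<^bsub>ext\<^esub> letter (atom_rep (g \<otimes> a \<otimes> h)) \<otimes>\<^bsub>ext\<^esub> unit_image (l \<otimes> h)"
    using a g h kl(1,2) by (intro atom_image_eq atom_left_mult atom_right_mult Units_m_closed)
  then show "atom_image (g \<otimes> a \<otimes> h) = unit_image g \<otimes>\<^bsub>ext\<^esub> atom_image a \<otimes>\<^bsub>ext\<^esub> unit_image h"
    unfolding rep img using g h kl(1,2) i
    by (simp add: unit_image_mult unit_image_closed letter_closed ext.m_assoc)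
qed

lemma atom_image_rep: "i \<in> atom_reps \<Longrightarrow> atom_image i = letter i"
  using atom_image_eq[OF atom_reps_atom, of i \<one> \<one>] atom_reps_atom[of i] atom_closed[of i]
  by (simp add: atom_rep_of_rep unit_image_one letter_closed)

lemma ex_hom_to_ext:
  "\<exists>\<phi>\<in>hom M ext. (\<forall>g\<in>Units M. \<phi> g = unit_image g) \<and> (\<forall>a. atom a \<longrightarrow> \<phi> a = atom_image a)"
proof -
  interpret letter_map M ext unit_image atom_image
  proof
    show "unit_image \<in> hom (units_of M) ext" by (rule HNN_base_hom[OF data])
    fix a g assume a: "atom a" and g: "g \<in> Units M"
    show "atom_image (g \<otimes> a) = unit_image g \<otimes>\<^bsub>ext\<^esub> atom_image a"
      using atom_image_mult[OF a g Units_one_closed] g a atom_image_mult(2)[OF a g g]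
      by (simp add: unit_image_one unit_image_closed atom_closed Units_closed)
    show "atom_image (a \<otimes> g) = atom_image a \<otimes>\<^bsub>ext\<^esub> unit_image g"
      using atom_image_mult[OF a Units_one_closed g] g a atom_image_mult(2)[OF a g g]
      by (simp add: unit_image_one unit_image_closed atom_closed Units_closed)
  qed (use atom_image_mult(2)[OF _ Units_one_closed Units_one_closed] in blast)
  show ?thesis by (rule ex_extension)
qed

text \<open>\<open>M\<close> is generated by its units and the representatives of the atoms.\<close>

lemma monoid_hom_eqI:
  assumes T: "group T" and \<phi>: "\<phi>\<^sub>1 \<in> hom M T" "\<phi>\<^sub>2 \<in> hom M T"
    and units: "\<And>g. g \<in> Units M \<Longrightarrow> \<phi>\<^sub>1 g = \<phi>\<^sub>2 g"
    and reps: "\<And>i. i \<in> atom_reps \<Longrightarrow> \<phi>\<^sub>1 i = \<phi>\<^sub>2 i"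
    and m: "m \<in> carrier M"
  shows "\<phi>\<^sub>1 m = \<phi>\<^sub>2 m"
  using m
proof (induction "height m" arbitrary: m rule: less_induct)
  case less
  show ?case
  proof (cases "m \<in> Units M")
    case True
    then show ?thesis by (rule units)
  next
    case False
    with less.prems obtain b c where bc: "b \<in> carrier M" "atom c" "m = b \<otimes> c"
      by (rule last_atom)
    have c: "c \<in> carrier M" "c \<notin> Units M" using bc(2) by (auto simp: atom_def)
    have b: "\<phi>\<^sub>1 b = \<phi>\<^sub>2 b" using less.hyps[of b] height_less[OF bc(1) c] bc by simp
    obtain g h where gh: "g \<in> Units M" "h \<in> Units M" "c = g \<otimes> atom_rep c \<otimes> h"
      using atom_rep_factor[OF c(1)] by blast
    have i: "atom_rep c \<in> atom_reps" using bc(2) by (rule atom_rep_in_reps)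
    then have iM: "atom_rep c \<in> carrier M" using atom_reps_atom atom_closed by blast
    have "m = b \<otimes> (g \<otimes> atom_rep c \<otimes> h)" using bc(3) gh(3) by simp
    then show ?thesis
      using bc(1) gh(1,2) iM b units reps[OF i]
      by (simp add: hom_mult[OF \<phi>(1)] hom_mult[OF \<phi>(2)] Units_closed)
  qed
qed

end

text \<open>The homomorphism \<open>\<phi>\<close> from \<open>M\<close> to the extension induces \<open>\<alpha>\<close> on the group of fractions, and the
  universal property of the extension gives \<open>\<beta>\<close> in the other direction. Each composite is the
  identity on generators.\<close>

lemma group_of_fractions_is_HNN_extension:
  fixes M :: "('a, 'm) monoid_scheme" and U :: "('u, 'n) monoid_scheme"
  assumes M: "left_rees_monoid M" "right_cancellative M" and frac: "is_group_of_fractions M U u"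
  shows "\<exists>(G :: 'a monoid) (I :: 'a set) H \<rho>. is_HNN_extension U G I H \<rho>"
proof -
  interpret monoid M using M(1) by (simp add: left_rees_monoid_def)
  interpret cancellative_left_rees M by unfold_locales (rule M)+
  have U: "group U" and u: "u \<in> hom M U" using frac by (auto simp: is_group_of_fractions_def)
  interpret U: group U by fact
  have facU: "factors_uniquely M U u U"
    by (rule group_of_fractions_universal[OF monoid_axioms frac U])
  have facE: "factors_uniquely M U u ext"
    by (rule group_of_fractions_universal[OF monoid_axioms frac ext.is_group])
  have repM: "i \<in> carrier M" if "i \<in> atom_reps" for i
    using that atom_reps_atom atom_closed by blast
  obtain \<phi> where \<phi>: "\<phi> \<in> hom M ext" "\<And>g. g \<in> Units M \<Longrightarrow> \<phi> g = unit_image g"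
    "\<And>a. atom a \<Longrightarrow> \<phi> a = atom_image a"
    using ex_hom_to_ext by auto
  obtain \<alpha> where \<alpha>: "\<alpha> \<in> hom U ext" "\<And>x. x \<in> carrier M \<Longrightarrow> \<alpha> (u x) = \<phi> x"
    by (rule factors_uniquelyE[OF facE \<phi>(1)]) (rule that)
  have "\<exists>\<beta>. \<beta> \<in> hom ext U \<inter> extensional (carrier ext) \<and>
      (\<forall>g\<in>carrier (units_of M). \<beta> (unit_image g) = u g) \<and> (\<forall>i\<in>atom_reps. \<beta> (letter i) = u i)"
  proof (rule ex1_implies_ex, rule HNN_universal[OF data U])
    show "u \<in> hom (units_of M) U"
      using u by (auto simp: hom_def units_of_carrier units_of_mult Units_closed)
    show "u \<in> atom_reps \<rightarrow> carrier U" using hom_in_carrier[OF u] repM by auto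
    fix i h assume i: "i \<in> atom_reps" and h: "h \<in> edge_group i"
    note G = edge_hom[OF repM[OF i] h]
    show "u h \<otimes>\<^bsub>U\<^esub> u i = u i \<otimes>\<^bsub>U\<^esub> u (edge_hom i h)"
      using G repM[OF i] by (simp add: Units_closed flip: hom_mult[OF u])
  qed
  then obtain \<beta> where \<beta>: "\<beta> \<in> hom ext U" "\<And>g. g \<in> Units M \<Longrightarrow> \<beta> (unit_image g) = u g"
    "\<And>i. i \<in> atom_reps \<Longrightarrow> \<beta> (letter i) = u i"
    by (auto simp: units_of_carrier)
  have \<beta>\<phi>: "\<beta> (\<phi> m) = u m" if "m \<in> carrier M" for m
  proof -
    have "(\<beta> \<circ> \<phi>) m = u m"
      by (rule monoid_hom_eqI[OF U Group.hom_compose[OF \<phi>(1) \<beta>(1)] u _ _ that])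
        (simp_all add: \<phi> \<beta> atom_reps_atom atom_image_rep)
    then show ?thesis by simp
  qed
  have \<beta>\<alpha>: "\<beta> (\<alpha> y) = y" if "y \<in> carrier U" for y
  proof -
    have "(\<beta> \<circ> \<alpha>) y = id y"
      by (rule factors_uniquely_eqI[OF facU monoid_axioms U u Group.hom_compose[OF \<alpha>(1) \<beta>(1)] _ _ that U])
        (simp_all add: \<alpha> \<beta>\<phi> hom_def)
    then show ?thesis by simp
  qed
  have \<alpha>\<beta>: "\<alpha> (\<beta> p) = p" if "p \<in> carrier ext" for p
  proof -
    have "(\<alpha> \<circ> \<beta>) p = id p"
      by (rule HNN_hom_eqI[OF data ext.is_group Group.hom_compose[OF \<beta>(1) \<alpha>(1)] _ _ _ that])
        (simp_all add: \<alpha> \<beta> \<phi> units_of_carrier Units_closed repM atom_reps_atom atom_image_rep hom_def)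
    then show ?thesis by simp
  qed
  have "bij_betw \<alpha> (carrier U) (carrier ext)"
    by (rule bij_betwI[of _ _ _ \<beta>])
      (use hom_in_carrier[OF \<alpha>(1)] hom_in_carrier[OF \<beta>(1)] \<beta>\<alpha> \<alpha>\<beta> in auto)
  then have "U \<cong> ext" using \<alpha>(1) by (auto simp: is_iso_def iso_def)
  then show ?thesis using data U unfolding is_HNN_extension_def by blast
qed

theorem mainTheorem2:
  shows
    "(\<forall>(M :: 'a monoid) (U :: 'u monoid) u.
        rees_monoid M \<and> is_group_of_fractions M U u \<longrightarrow>
        (\<exists>(G :: 'a monoid) (I :: 'a set) H \<rho>. is_HNN_extension U G I H \<rho>)) \<and>
     (\<forall>(G :: 'g monoid) (I :: 'i set) H \<rho> (E :: 'e monoid).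
        is_HNN_extension E G I H \<rho> \<longrightarrow>
        (\<exists>(M :: 'e monoid) u. rees_monoid M \<and> is_group_of_fractions M E u))"
proof (intro conjI allI impI)
  fix M :: "'a monoid" and U :: "'u monoid" and u
  assume "rees_monoid M \<and> is_group_of_fractions M U u"
  then show "\<exists>(G :: 'a monoid) (I :: 'a set) H \<rho>. is_HNN_extension U G I H \<rho>"
    by (intro group_of_fractions_is_HNN_extension[of M U u])
      (auto simp: rees_monoid_def right_rees_monoid_def)
next
  fix G :: "'g monoid" and I :: "'i set" and H \<rho> and E :: "'e monoid"
  assume "is_HNN_extension E G I H \<rho>"
  then show "\<exists>(M :: 'e monoid) u. rees_monoid M \<and> is_group_of_fractions M E u"
    by (rule HNN_extension_is_group_of_fractions)
qed

end
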